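(* For every large enough absolute constant $K$ (i.e. there is an absolute constant $K_0$ such that the following holds for every $K\ge K_0$): suppose $0<\eta<\frac1{8000000}K^{-2}$, and the initialization $(x_0,y_0)$ satisfies $x_0\in(\breve x+13\eta^{5/4},\ \breve x+\frac15K^{-2}\eta^{-1/2})$ and $|x_0y_0-1|\in(0,K^{-1})$, where $\breve x=\frac1{\sqrt2}\left((\eta^{-2}-4)^{1/2}+\eta^{-1}\right)^{1/2}$. Then the gradient descent trajectory $$x_{t+1}=x_t-\eta x_ty_t^2(x_t^2y_t^2-1),\qquad y_{t+1}=y_t-\eta x_t^2y_t(x_t^2y_t^2-1)$$ with fixed step size $\eta$ from $(x_0,y_0)$ converges to a global minimum whose sharpness $\lambda$ satisfies $\lambda\in\left(\frac2\eta-\frac{20}3\eta,\ \frac2\eta\right)$.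
   Context: The trajectory is gradient descent on $\mathcal L(x,y,z,w)=\frac12(1-xyzw)^2$ with coupled initialization $z_0=x_0$, $w_0=y_0$ (the coupling $z_t=x_t$, $w_t=y_t$ is preserved). A global minimum is a point $(x,y)$ with $x^2y^2=1$. The sharpness at $(x,y)$ is the largest eigenvalue of the $4\times4$ Hessian of $\mathcal L$ at the point with $z=x$, $w=y$. The point $(\breve x,1/\breve x)$ is the global minimum with sharpness exactly $2/\eta$ ("$\eta$-EoS minimum"). *)

theory Defs
  imports "HOL-Analysis.Analysis"
begin

definition partial_deriv :: "'n::finite \<Rightarrow> (real^'n \<Rightarrow> real) \<Rightarrow> real^'n \<Rightarrow> real" where
  "partial_deriv i f p = deriv (\<lambda>t. f (p + t *\<^sub>R axis i 1)) 0"

definition hessian :: "(real^'n::finite \<Rightarrow> real) \<Rightarrow> real^'n \<Rightarrow> real^'n^'n" where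
  "hessian f p = (\<chi> i j. partial_deriv i (partial_deriv j f) p)"

definition eigenvalues :: "real^'n^'n::finite \<Rightarrow> real set" where
  "eigenvalues A = {l. \<exists>v. v \<noteq> 0 \<and> A *v v = l *\<^sub>R v}"

text \<open>The coordinates of a point of \<open>real^4\<close> are \<open>(x, y, z, w)\<close>, in this order.\<close>

definition loss :: "real^4 \<Rightarrow> real" where
  "loss p = (1/2) * (1 - p$1 * p$2 * p$3 * p$4)^2"

text \<open>
  Under the coupling \<open>z = x\<close>, \<open>w = y\<close>, a pair \<open>(x, y)\<close> stands for the point
  \<open>(x, y, x, y)\<close>; the Hessian is nevertheless taken with respect to all four variables.
  The set of its eigenvalues is finite, and it is nonempty because the Hessian is symmetric,
  so \<open>Max\<close> is the genuine maximum.
\<close>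

definition sharpness :: "real \<Rightarrow> real \<Rightarrow> real" where
  "sharpness x y = Max (eigenvalues (hessian loss (vector [x, y, x, y])))"

definition global_minimum :: "real \<Rightarrow> real \<Rightarrow> bool" where
  "global_minimum x y \<longleftrightarrow> x^2 * y^2 = 1"

text \<open>The \<open>x\<close>-coordinate of the global minimum \<open>(x, 1/x)\<close> of sharpness exactly \<open>2/\<eta>\<close>.\<close>

definition x_eos :: "real \<Rightarrow> real" where
  "x_eos \<eta> = 1 / sqrt 2 * sqrt (sqrt (1 / \<eta>^2 - 4) + 1 / \<eta>)"

text \<open>
  Gradient descent on \<^const>\<open>loss\<close> with step size \<open>\<eta>\<close> preserves the coupling \<open>z = x\<close>, \<open>w = y\<close>;
  on coupled points it is the following recursion in \<open>(x, y)\<close>.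
\<close>

definition gd_trajectory :: "real \<Rightarrow> (nat \<Rightarrow> real) \<Rightarrow> (nat \<Rightarrow> real) \<Rightarrow> bool" where
  "gd_trajectory \<eta> x y \<longleftrightarrow>
     (\<forall>t. x (Suc t) = x t - \<eta> * x t * (y t)^2 * ((x t)^2 * (y t)^2 - 1) \<and>
          y (Suc t) = y t - \<eta> * (x t)^2 * y t * ((x t)^2 * (y t)^2 - 1))"

end

theory Submission
  imports Defs
begin

text \<open>
  Put \<open>D = x\<^sup>2 - y\<^sup>2\<close>, \<open>\<delta> = x y - 1\<close> and \<open>\<epsilon> = \<eta> sqrt (D\<^sup>2 + 4) - 1\<close>; a global minimum with this value of
  \<open>D\<close> has sharpness \<open>2 (1 + \<epsilon>) / \<eta>\<close>. One step multiplies \<open>D\<close> by \<open>1 - \<eta>\<^sup>2 x\<^sup>2 y\<^sup>2 (x\<^sup>2 y\<^sup>2 - 1)\<^sup>2\<close>, so that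
  \<open>\<epsilon>\<close> decreases slowly, while \<open>\<delta>\<close> is multiplied by about \<open>- (1 + 2 \<epsilon> + 3 \<delta> + \<delta>\<^sup>2)\<close>. Over two steps the
  term linear in \<open>\<delta>\<close> cancels, and \<open>u = \<delta>\<^sup>2\<close> satisfies \<open>u' \<approx> u (1 + 8 \<epsilon> - 32 u)\<close>,
  \<open>\<epsilon>' \<approx> \<epsilon> - 8 \<eta>\<^sup>2 u\<close>. In the variables \<open>v = u / \<eta>\<^sup>2\<close>, \<open>e = \<epsilon> / \<eta>\<^sup>2\<close> this is a discretization of the linear
  equation \<open>dv/de = 4 v - e\<close>, traversed with \<open>e\<close> decreasing. The half-plane \<open>v \<le> e/2 + 1\<close> is a trap.
  Outside of it \<open>v exp (- 3 e / 2)\<close> decreases, so a large initial \<open>e\<close> leaves enough room to fall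
  into the trap while \<open>e > 0\<close>. As long as \<open>e \<ge> 0\<close> the quantity \<open>v exp (- 5 e)\<close> increases, so \<open>u\<close> stays away
  from \<open>0\<close> and \<open>e\<close> becomes negative in finite time. From then on \<open>v\<close> tends to \<open>0\<close> geometrically, and
  \<open>v + 2 e\<^sup>2 / 5\<close> decreases, which keeps \<open>e \<ge> - 2\<close>.
\<close>

subsection \<open>Sharpness of global minima\<close>

lemma vector_4:
  "(vector [a, b, c, d] :: 'a::zero^4) $ 1 = a"
  "(vector [a, b, c, d] :: 'a::zero^4) $ 2 = b"
  "(vector [a, b, c, d] :: 'a::zero^4) $ 3 = c"
  "(vector [a, b, c, d] :: 'a::zero^4) $ 4 = d"
  unfolding vector_def by simp_all

definition coord_prod :: "real^4 \<Rightarrow> real" where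
  "coord_prod p = p$1 * p$2 * p$3 * p$4"

text \<open>The directional derivative of \<open>coord_prod\<close> at \<open>p\<close> along
  \<open>a\<close>.\<close>

definition coord_prod_deriv :: "real^4 \<Rightarrow> real^4 \<Rightarrow> real" where
  "coord_prod_deriv p a = a$1 * p$2 * p$3 * p$4 + p$1 * a$2 * p$3 * p$4
     + p$1 * p$2 * a$3 * p$4 + p$1 * p$2 * p$3 * a$4"

section \<open>Gradient of the loss, and its Hessian at a minimum\<close>

lemma DERIV_coord_prod:
  "((\<lambda>t. coord_prod (p + t *\<^sub>R a)) has_real_derivative coord_prod_deriv p a) (at 0)"
  unfolding coord_prod_def coord_prod_deriv_def
  by (auto intro!: derivative_eq_intros simp: algebra_simps)

lemma partial_deriv_loss:
  "partial_deriv i loss p = - (1 - coord_prod p) * coord_prod_deriv p (axis i 1)"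
proof -
  have loss: "loss = (\<lambda>p. (1/2) * (1 - coord_prod p)^2)"
    by (simp add: fun_eq_iff loss_def coord_prod_def)
  have "((\<lambda>t. (1/2) * (1 - coord_prod (p + t *\<^sub>R axis i 1))^2)
      has_real_derivative - (1 - coord_prod p) * coord_prod_deriv p (axis i 1)) (at 0)"
    by (auto intro!: derivative_eq_intros DERIV_coord_prod simp: field_simps)
  thus ?thesis unfolding partial_deriv_def loss by (rule DERIV_imp_deriv)
qed

text \<open>The second derivatives of the product enter the Hessian multiplied by the residual
  \<open>1 - coord_prod p\<close>, which vanishes here. What survives is the outer product of the
  gradient of \<open>coord_prod\<close> with itself.\<close>

lemma hessian_loss_at_minimum:
  assumes "coord_prod p = 1"
  shows "hessian loss p $ i $ j = coord_prod_deriv p (axis i 1) * coord_prod_deriv p (axis j 1)"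
proof -
  define B where "B = (\<lambda>t. coord_prod_deriv (p + t *\<^sub>R axis i 1) (axis j 1))"
  \<comment> \<open>Differentiability of \<open>B\<close> suffices: its derivative is multiplied by
    the residual 0, so its value is irrelevant.\<close>
  have "\<exists>B'. (B has_real_derivative B') (at 0)"
    unfolding B_def coord_prod_deriv_def by (rule exI) (auto intro!: derivative_eq_intros)
  then obtain B' where "(B has_real_derivative B') (at 0)" ..
  hence "((\<lambda>t. - (1 - coord_prod (p + t *\<^sub>R axis i 1)) * B t) has_real_derivative
      coord_prod_deriv p (axis i 1) * B 0) (at 0)"
    using assms by (auto intro!: derivative_eq_intros DERIV_coord_prod)
  hence "partial_deriv i (\<lambda>p. - (1 - coord_prod p) * coord_prod_deriv p (axis j 1)) p
      = coord_prod_deriv p (axis i 1) * B 0"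
    unfolding partial_deriv_def B_def by (rule DERIV_imp_deriv)
  moreover have "hessian loss p $ i $ j = partial_deriv i (\<lambda>p. - (1 - coord_prod p) * coord_prod_deriv p (axis j 1)) p"
    unfolding hessian_def partial_deriv_loss[abs_def] by simp
  ultimately show ?thesis by (simp add: B_def)
qed

lemma hessian_rank_one:
  fixes x y :: real
  assumes xy: "x * y = 1"
  shows "hessian loss (vector [x, y, x, y]) $ i $ j
    = (vector [y, x, y, x] :: real^4) $ i * (vector [y, x, y, x] :: real^4) $ j"
proof -
  have "coord_prod (vector [x, y, x, y]) = (x * y) * (x * y)"
    unfolding coord_prod_def vector_4 by (simp add: algebra_simps)
  moreover have "coord_prod_deriv (vector [x, y, x, y]) (axis k 1) = (vector [y, x, y, x] :: real^4) $ k" for k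
  proof -
    have "coord_prod_deriv (vector [x, y, x, y]) a
        = (x * y) * (y * a $ 1 + x * a $ 2 + y * a $ 3 + x * a $ 4)" for a
      unfolding coord_prod_deriv_def vector_4 by (simp add: algebra_simps)
    thus ?thesis using exhaust_4[of k] xy by (auto simp: vector_4 axis_def)
  qed
  ultimately show ?thesis using xy by (simp add: hessian_loss_at_minimum)
qed

text \<open>The Hessian is \<open>g\<close> times its transpose with
  \<open>g = (y, x, y, x)\<close>, so its only eigenvalues are the squared norm of \<open>g\<close>
  and 0.\<close>

lemma sharpness_at_minimum:
  fixes x y :: real
  assumes xy: "x * y = 1"
  shows "sharpness x y = 2 * (x^2 + y^2)"
proof -
  define g :: "real^4" where "g = vector [y, x, y, x]"
  have A: "hessian loss (vector [x, y, x, y]) *v v = (g \<bullet> v) *\<^sub>R g" for v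
    by (simp add: hessian_rank_one[OF xy] g_def[symmetric] vec_eq_iff matrix_vector_mult_def inner_vec_def sum_distrib_right sum_distrib_left mult_ac)
  have gg: "g \<bullet> g = 2 * (x^2 + y^2)" unfolding g_def inner_vec_def
    by (simp add: sum_4 vector_4 power2_eq_square)
  have g0: "g \<noteq> 0"
  proof
    assume "g = 0" hence "g $ 2 = 0" by simp
    thus False using xy by (simp add: g_def vector_4)
  qed
  \<comment> \<open>A nonzero vector orthogonal to \<open>g\<close> for all \<open>x\<close> and
    \<open>y\<close>: it witnesses the eigenvalue 0.\<close>
  define v :: "real^4" where "v = vector [1, 0, -1, 0]"
  have v: "v \<noteq> 0" "g \<bullet> v = 0"
    by (auto simp: v_def g_def inner_vec_def sum_4 vec_eq_iff forall_4 vector_4)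
  have "eigenvalues (hessian loss (vector [x, y, x, y])) = {0, 2 * (x^2 + y^2)}"
  proof (intro set_eqI iffI)
    fix l assume "l \<in> eigenvalues (hessian loss (vector [x, y, x, y]))"
    then obtain w where w: "w \<noteq> 0" "(g \<bullet> w) *\<^sub>R g = l *\<^sub>R w" unfolding eigenvalues_def A by auto
    have "(g \<bullet> w) * (g \<bullet> g) = l * (g \<bullet> w)" using arg_cong[OF w(2), of "\<lambda>z. g \<bullet> z"] by simp
    moreover have "g \<bullet> w = 0 \<Longrightarrow> l = 0" using w by simp
    ultimately show "l \<in> {0, 2 * (x^2 + y^2)}" using gg by auto
  next
    fix l assume "l \<in> {0, 2 * (x^2 + y^2)}"
    thus "l \<in> eigenvalues (hessian loss (vector [x, y, x, y]))"
      using v g0 gg unfolding eigenvalues_def A by fastforce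
  qed
  thus ?thesis unfolding sharpness_def by (simp add: max_def)
qed

subsection \<open>One and two steps of gradient descent\<close>

text \<open>Here \<open>m\<close> is the relative loss of \<open>D\<close> in one step. The
  difference of squares \<open>s^2 - s'^2\<close> is
  \<open>(s^2 - 4*\<eta>^2) * m * (2 - m)\<close>, about \<open>2 * m\<close>, and
  \<open>s + s'\<close> is about 2; dividing shows that \<open>s\<close> drops by about
  \<open>m\<close>.\<close>

lemma one_step_balance:
  fixes D m s s' \<eta> :: real
  assumes eta: "0 < \<eta>" "\<eta> \<le> 1/1000000000"
    and m: "0 \<le> m" "m \<le> 1/1000"
    and s: "s = \<eta> * sqrt (D^2 + 4)" and s': "s' = \<eta> * sqrt ((D * (1 - m))^2 + 4)"
    and s1: "\<bar>s - 1\<bar> \<le> 1/1000"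
  shows "s - 101/100 * m \<le> s'" "s' \<le> s - 99/100 * m"
proof -
  have sq: "s^2 = \<eta>^2 * (D^2 + 4)" "s'^2 = \<eta>^2 * ((D * (1 - m))^2 + 4)"
    unfolding s s' by (simp_all add: power_mult_distrib)
  have s'0: "s' \<ge> 0" unfolding s' using eta by simp
  have "\<eta>^2 \<le> (1/1000000000)^2" using eta by (intro power_mono) auto
  hence e2: "0 \<le> \<eta>^2" "\<eta>^2 \<le> 1/1000000000" by (simp_all add: power2_eq_square)
  have diff: "(s - s') * (s + s') = (s^2 - 4*\<eta>^2) * (m * (2 - m))"
  proof -
    have "(s - s') * (s + s') = s^2 - s'^2" by (simp add: power2_eq_square algebra_simps)
    also have "\<dots> = (s^2 - 4*\<eta>^2) * (m * (2 - m))"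
      unfolding sq by (simp add: power2_eq_square algebra_simps)
    finally show ?thesis .
  qed
  have sb: "999/1000 \<le> s" "s \<le> 1001/1000" using s1 by linarith+
  have "s^2 \<ge> (999/1000)^2" using sb by (intro power_mono) auto
  hence "s^2 \<ge> 998001/1000000" by (simp add: power2_eq_square)
  hence s2: "s^2 - 4*\<eta>^2 \<ge> 997/1000" using e2 by linarith
  have "s^2 \<le> (1001/1000)^2" using sb by (intro power_mono) auto
  hence "s^2 \<le> 1002001/1000000" by (simp add: power2_eq_square)
  hence s2': "s^2 - 4*\<eta>^2 \<le> 1003/1000" using e2 by linarith
  have rhs0: "(s^2 - 4*\<eta>^2) * (m * (2 - m)) \<ge> 0" using s2 m by simp
  have le: "s' \<le> s"
  proof (rule ccontr)
    assume "\<not> s' \<le> s"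
    hence "(s - s') * (s + s') < 0" using sb s'0 by (intro mult_neg_pos) auto
    thus False using rhs0 diff by simp
  qed
  \<comment> \<open>Scaling the summand 4 along with \<open>D^2\<close> could only make the root
    smaller. This keeps \<open>s'\<close> close to 1, as needed for the upper bound on the
    drop.\<close>
  have ge: "(1 - m) * s \<le> s'"
  proof (rule power2_le_imp_le[OF _ s'0])
    have "((1 - m) * s)^2 = (1-m)^2 * s^2" by (simp add: power_mult_distrib)
    also have "\<dots> = \<eta>^2 * ((D * (1 - m))^2 + 4 * (1-m)^2)"
      unfolding sq by (simp add: power2_eq_square algebra_simps)
    also have "\<dots> \<le> \<eta>^2 * ((D * (1 - m))^2 + 4 * 1)"
      using m by (intro mult_left_mono add_left_mono) (auto simp: power_le_one)
    finally show "((1 - m) * s)^2 \<le> s'^2" unfolding sq by simp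
  qed
  have "(1 - m) * s \<ge> 999/1000 * (999/1000)" using m sb by (intro mult_mono) auto
  hence s'b: "s' \<ge> 998/1000" using ge by simp
  have "(s - s') * (1996/1000) \<le> (s - s') * (s + s')"
    using le s'b sb by (intro mult_left_mono) auto
  also have "\<dots> \<le> (1003/1000) * (m * 2)"
    unfolding diff using s2 s2' m by (intro mult_mono) auto
  finally show "s - 101/100 * m \<le> s'" using m by (simp add: field_simps)
  have "(997/1000) * (m * (1999/1000)) \<le> (s - s') * (s + s')"
    unfolding diff using s2 s2' m by (intro mult_mono) auto
  also have "\<dots> \<le> (s - s') * (2002/1000)"
    using le sb by (intro mult_left_mono) auto
  finally show "s' \<le> s - 99/100 * m" using m by (simp add: field_simps)
qed

text \<open>With \<open>q = x y\<close> and \<open>\<sigma> = \<eta> (x^2 + y^2)\<close> the first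
  expression is the new residual. Since \<open>q^2 - 1 = \<delta> * (2 + \<delta>)\<close>, a factor
  \<delta> splits off, and \<open>- 1 + (1 + \<delta>) * (2 + \<delta>) * s\<close> gives the main
  terms. The correction \<open>4 * \<eta>^2 * \<delta>\<close> is linear in \<delta>, so an error of
  size \<open>\<bar>\<epsilon>\<bar> + \<delta>^2\<close> cannot absorb it in general; it is kept in
  the coefficient of \<delta>, where two steps cancel it.\<close>

lemma gd_ratio:
  fixes \<eta> q s \<sigma> \<delta> \<epsilon> :: real
  assumes eta: "0 < \<eta>" "\<eta> \<le> 1/1000000000"
    and q: "q = 1 + \<delta>" and s: "s = 1 + \<epsilon>" and sig: "\<sigma>^2 - s^2 = 4 * \<eta>^2 * (q^2 - 1)" "\<sigma> \<ge> 0"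
    and d: "\<bar>\<delta>\<bar> \<le> 2/10000" and e: "\<bar>\<epsilon>\<bar> \<le> 2/100000000"
  shows "\<exists>\<rho>. q * (1 - \<sigma> * (q^2 - 1) + \<eta>^2 * q^2 * (q^2 - 1)^2) - 1 = - \<rho> * \<delta> \<and>
     \<bar>\<rho> - (1 + 2 * \<epsilon> + (3 + 4 * \<eta>^2) * \<delta> + \<delta>^2)\<bar> \<le> (\<bar>\<epsilon>\<bar> + \<delta>^2) / 1000"
proof -
  have "\<eta>^2 \<le> (1/1000000000)^2" using eta by (intro power_mono) auto
  hence e2: "0 \<le> \<eta>^2" "\<eta>^2 \<le> 1/1000000000" by (simp_all add: power2_eq_square)
  \<comment> \<open>Chosen so that \<open>\<sigma> = s + \<eta>^2 * g * (q^2 - 1)\<close> holds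
    exactly; \<open>g\<close> is near 2 because \<sigma> and \<open>s\<close> are near 1.\<close>
  define g where "g = 4 / (\<sigma> + s)"
  have ss: "\<sigma> + s \<ge> 999/1000" using sig(2) e s by auto
  have r: "q^2 - 1 = \<delta> * (2 + \<delta>)" unfolding q by (simp add: power2_eq_square algebra_simps)
  have sg: "\<sigma> = s + \<eta>^2 * g * (q^2 - 1)"
  proof -
    have "(\<sigma> - s) * (\<sigma> + s) = 4 * \<eta>^2 * (q^2 - 1)" using sig by (simp add: power2_eq_square algebra_simps)
    hence "\<sigma> - s = \<eta>^2 * g * (q^2 - 1)" unfolding g_def using ss by (simp add: field_simps)
    thus ?thesis by simp
  qed
  \<comment> \<open>The product has the value \<open>1 * 4 * (2 - 1) = 4\<close> at
    \<open>\<delta> = 0\<close>, \<open>g = 2\<close>; \<open>c\<close> is the deviation from it,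
    which is small.\<close>
  define c where "c = (1 + \<delta>) * (2 + \<delta>)^2 * (g - q^2) - 4"
  define \<rho> where "\<rho> = -1 + q * (2 + \<delta>) * s + \<eta>^2 * \<delta> * (c + 4)"
  have ceq: "c + 4 = q * (2 + \<delta>)^2 * (g - q^2)" unfolding c_def q by simp
  have 1: "q * (1 - \<sigma> * (q^2 - 1) + \<eta>^2 * q^2 * (q^2 - 1)^2) - 1 = - \<rho> * \<delta>"
  proof -
    have "q * (1 - \<sigma> * (q^2 - 1) + \<eta>^2 * q^2 * (q^2 - 1)^2) - 1
       = \<delta> - q * (q^2-1) * s + \<eta>^2 * (q^2-1)^2 * q * (q^2 - g)"
      unfolding sg using q by (simp add: power2_eq_square algebra_simps)
    also have "\<dots> = - \<rho> * \<delta>" unfolding r \<rho>_def ceq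
      by (simp add: power2_eq_square algebra_simps)
    finally show ?thesis .
  qed
  have 2: "\<rho> - (1 + 2 * \<epsilon> + (3 + 4 * \<eta>^2) * \<delta> + \<delta>^2) = \<epsilon> * (\<delta> * (3 + \<delta>)) + \<eta>^2 * (\<delta> * c)"
    unfolding \<rho>_def q s by (simp add: power2_eq_square algebra_simps)
  define n where "n = \<bar>\<delta>\<bar> + \<bar>\<epsilon>\<bar>"
  have n: "\<bar>\<delta>\<bar> \<le> n" "\<bar>\<epsilon>\<bar> \<le> n" "n \<le> 1/1000" unfolding n_def using d e by simp_all
  have g4: "0 \<le> g" "g \<le> 5" unfolding g_def using ss by (auto simp: field_simps)
  have r3: "\<bar>q^2 - 1\<bar> \<le> 3 * \<bar>\<delta>\<bar>"
    unfolding r abs_mult using d by (subst mult.commute, intro mult_right_mono) auto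
  have "\<bar>\<sigma> - s\<bar> = \<eta>^2 * (g * \<bar>q^2 - 1\<bar>)" unfolding sg using g4 e2 by (simp add: abs_mult)
  also have "\<dots> \<le> 1/1000000000 * (5 * (3 * \<bar>\<delta>\<bar>))"
    using g4 e2 r3 by (intro mult_mono) auto
  finally have sd: "\<bar>\<sigma> - s\<bar> \<le> n" using n by linarith
  have "g - 2 = (2 - \<sigma> - s) * 2 / (\<sigma> + s)" unfolding g_def using ss by (simp add: field_simps)
  hence "\<bar>g - 2\<bar> = \<bar>2 - \<sigma> - s\<bar> * 2 / (\<sigma> + s)" using ss
    by (simp only: abs_mult abs_divide)
  also have "\<dots> \<le> (3 * n) * 2 / (1/2)"
  proof (intro frac_le mult_right_mono)
    show "\<bar>2 - \<sigma> - s\<bar> \<le> 3 * n" using sd n unfolding s by linarith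
  qed (use ss in \<open>auto simp: n_def\<close>)
  finally have g2: "\<bar>g - 2\<bar> \<le> 12 * n" by simp
  have h: "\<bar>g - q^2 - 1\<bar> \<le> 15 * n" using g2 r3 n by linarith
  define k where "k = (1 + \<delta>) * (2 + \<delta>)^2"
  have k: "k - 4 = \<delta> * (8 + 5 * \<delta> + \<delta>^2)" unfolding k_def by (simp add: power2_eq_square algebra_simps)
  have d2: "\<delta>^2 \<le> 1" using d by (simp add: abs_square_le_1)
  have "\<bar>k - 4\<bar> \<le> \<bar>\<delta>\<bar> * 14" unfolding k abs_mult using d d2 by (intro mult_left_mono) auto
  hence k4: "\<bar>k - 4\<bar> \<le> 14 * n" using n by linarith
  have kb: "\<bar>k\<bar> \<le> 18" using k4 n by linarith
  have "c = k * (g - q^2 - 1) + (k - 4)" unfolding c_def k_def by (simp add: algebra_simps)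
  hence "\<bar>c\<bar> \<le> \<bar>k\<bar> * \<bar>g - q^2 - 1\<bar> + \<bar>k - 4\<bar>" by (metis abs_mult abs_triangle_ineq)
  also have "\<dots> \<le> 18 * (15 * n) + 14 * n" using kb h k4 by (intro add_mono mult_mono) auto
  finally have cb: "\<bar>c\<bar> \<le> 300 * n" using n by linarith
  have "\<bar>\<delta> * c\<bar> \<le> \<bar>\<delta>\<bar> * (300 * n)" unfolding abs_mult using cb by (intro mult_left_mono) auto
  also have "\<dots> = 300 * (\<delta>^2 + \<bar>\<delta>\<bar> * \<bar>\<epsilon>\<bar>)" unfolding n_def by (simp add: algebra_simps power2_eq_square)
  also have "\<bar>\<delta>\<bar> * \<bar>\<epsilon>\<bar> \<le> 1 * \<bar>\<epsilon>\<bar>" using d by (intro mult_right_mono) auto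
  finally have dc: "\<bar>\<delta> * c\<bar> \<le> 300 * (\<delta>^2 + \<bar>\<epsilon>\<bar>)" by simp
  define E1 where "E1 = \<epsilon> * (\<delta> * (3 + \<delta>))"
  define E2 where "E2 = \<eta>^2 * (\<delta> * c)"
  have "\<bar>\<delta> * (3 + \<delta>)\<bar> \<le> (2/10000) * 4" unfolding abs_mult using d by (intro mult_mono) auto
  hence "\<bar>E1\<bar> \<le> \<bar>\<epsilon>\<bar> * ((2/10000) * 4)"
    unfolding E1_def abs_mult[of \<epsilon>] by (intro mult_left_mono) auto
  moreover have "\<bar>E2\<bar> \<le> (1/1000000000) * (300 * (\<delta>^2 + \<bar>\<epsilon>\<bar>))"
    using e2 dc unfolding E2_def abs_mult[of "\<eta>^2"] by (intro mult_mono) auto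
  moreover have "0 \<le> \<bar>\<epsilon>\<bar>" "0 \<le> \<delta>^2" by simp_all
  ultimately have "\<bar>E1 + E2\<bar> \<le> (\<bar>\<epsilon>\<bar> + \<delta>^2) / 1000"
    using abs_triangle_ineq[of E1 E2] by argo
  with 1 2 show ?thesis unfolding E1_def E2_def by metis
qed

text \<open>The residual changes sign, so the linear terms \<open>a * \<delta>\<close> and
  \<open>- a * \<delta>\<close> of the two multipliers cancel for every \<open>a\<close>. At second
  order each step contributes \<open>2 * \<epsilon> + \<delta>^2\<close>, and the linear terms leave
  \<open>- 2 * a^2 * \<delta>^2\<close>, about \<open>- 18 * \<delta>^2\<close>; hence the
  coefficients 4 and \<open>- 16 = 2 - 18\<close>.\<close>

lemma two_step_multiplier:
  fixes a \<rho> \<rho>' \<delta> \<epsilon> \<epsilon>' E E' :: real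
  assumes a: "3 \<le> a" "a \<le> 3 + 1/1000"
    and r: "\<rho> = 1 + 2 * \<epsilon> + a * \<delta> + \<delta>^2 + E" and E: "\<bar>E\<bar> \<le> (\<bar>\<epsilon>\<bar> + \<delta>^2) / 1000"
    and r': "\<rho>' = 1 + 2 * \<epsilon>' + a * (- \<rho> * \<delta>) + (- \<rho> * \<delta>)^2 + E'"
    and E': "\<bar>E'\<bar> \<le> (\<bar>\<epsilon>'\<bar> + (- \<rho> * \<delta>)^2) / 1000"
    and ee: "\<bar>\<epsilon>' - \<epsilon>\<bar> \<le> \<delta>^2 / 1000"
    and d: "\<bar>\<delta>\<bar> \<le> 1/10000" and e: "\<bar>\<epsilon>\<bar> \<le> 1/100000000"
  shows "\<bar>\<rho> * \<rho>' - (1 + 4 * \<epsilon> - 16 * \<delta>^2)\<bar> \<le> (\<bar>\<epsilon>\<bar> + \<delta>^2) / 10"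
proof -
  define N where "N = \<bar>\<epsilon>\<bar> + \<delta>^2"
  have "\<delta>^2 = \<bar>\<delta>\<bar> * \<bar>\<delta>\<bar>" by (simp add: power2_eq_square)
  hence dd: "\<delta>^2 \<le> (1/10000) * (1/10000)" using mult_mono[OF d d] by simp
  have N: "0 \<le> N" "N \<le> 2/100000000" "\<bar>\<epsilon>\<bar> \<le> N" "\<delta>^2 \<le> N" using e d dd zero_le_power2[of \<delta>] unfolding N_def by auto
  define A where "A = 2 * \<epsilon> + \<delta>^2 + E"
  define m where "m = a * \<delta> + A"
  have EN: "\<bar>E\<bar> \<le> N / 1000" using E unfolding N_def .
  have eN: "\<bar>2 * \<epsilon> + \<delta>^2\<bar> \<le> 2 * N" unfolding N_def
    by (rule abs_leI) (use zero_le_power2[of \<delta>] abs_ge_self[of \<epsilon>] abs_ge_minus_self[of \<epsilon>] in argo)+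
  have "\<bar>A\<bar> \<le> \<bar>2 * \<epsilon> + \<delta>^2\<bar> + \<bar>E\<bar>" unfolding A_def by (rule abs_triangle_ineq)
  hence A: "\<bar>A\<bar> \<le> 3 * N" "\<bar>A - 2 * \<epsilon> - \<delta>^2\<bar> \<le> N / 1000"
    using EN eN N(1) by (simp_all add: A_def)
  have ad: "\<bar>a * \<delta>\<bar> \<le> 31/10 * \<bar>\<delta>\<bar>" unfolding abs_mult using a by (intro mult_right_mono) auto
  have m: "\<bar>m\<bar> \<le> 4/10000"
    using abs_triangle_ineq[of "a * \<delta>" A] ad A(1) d N(2) unfolding m_def by argo
  have rm: "\<rho> = 1 + m" unfolding r m_def A_def by simp
  have "\<bar>\<rho>^2 - 1\<bar> = \<bar>m\<bar> * \<bar>2 + m\<bar>" unfolding rm abs_mult[symmetric] by (simp add: power2_eq_square algebra_simps)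
  also have "\<dots> \<le> (4/10000) * 3" using m by (intro mult_mono) auto
  finally have r2: "\<bar>\<rho>^2 - 1\<bar> \<le> 12/10000" by simp
  define w where "w = (\<rho>^2 - 1) * \<delta>^2"
  have w: "\<bar>w\<bar> \<le> 12/10000 * N" unfolding w_def abs_mult using r2 N by (intro mult_mono) auto
  have rd: "(- \<rho> * \<delta>)^2 = \<delta>^2 + w" unfolding w_def by (simp add: power2_eq_square algebra_simps)
  define B where "B = 2 * \<epsilon>' + (\<delta>^2 + w) + E'"
  have ee': "\<bar>\<epsilon>' - \<epsilon>\<bar> \<le> N / 1000" using ee N(4) by linarith
  have "\<bar>\<epsilon>'\<bar> \<le> N + N / 1000" using ee' N(3) abs_triangle_ineq[of "\<epsilon>' - \<epsilon>" \<epsilon>] by simp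
  hence "\<bar>E'\<bar> \<le> ((N + N / 1000) + (N + 12/10000 * N)) / 1000"
    using E' N(4) w unfolding rd by (simp add: field_simps)
  hence E'b: "\<bar>E'\<bar> \<le> 3 * N / 1000" using N(1) by (simp add: field_simps)
  have "B - 2 * \<epsilon> - \<delta>^2 = 2 * (\<epsilon>' - \<epsilon>) + w + E'" unfolding B_def by simp
  moreover have "\<bar>2 * (\<epsilon>' - \<epsilon>) + w + E'\<bar> \<le> \<bar>2 * (\<epsilon>' - \<epsilon>)\<bar> + \<bar>w\<bar> + \<bar>E'\<bar>"
    by (intro order_trans[OF abs_triangle_ineq] add_right_mono abs_triangle_ineq)
  moreover have "\<bar>2 * (\<epsilon>' - \<epsilon>)\<bar> = 2 * \<bar>\<epsilon>' - \<epsilon>\<bar>" by (simp only: abs_mult)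
  ultimately have B1: "\<bar>B - 2 * \<epsilon> - \<delta>^2\<bar> \<le> 10 * N / 1000" using E'b ee' w N(1) by argo
  have "\<bar>B\<bar> \<le> \<bar>B - 2 * \<epsilon> - \<delta>^2\<bar> + \<bar>2 * \<epsilon> + \<delta>^2\<bar>"
    using abs_triangle_ineq[of "B - 2 * \<epsilon> - \<delta>^2" "2 * \<epsilon> + \<delta>^2"] by simp
  hence B2: "\<bar>B\<bar> \<le> 4 * N" using B1 eN N(1) by argo
  have "\<rho>' = 1 + a * (- \<rho> * \<delta>) + B" using r' rd unfolding B_def by simp
  hence r'm: "\<rho>' = 1 - a * \<delta> * (1 + m) + B" unfolding rm by (simp add: algebra_simps)
  \<comment> \<open>An exact expansion of \<open>(1 + m) * (1 - a * \<delta> * (1 + m) + B)\<close>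
    with \<open>m = a * \<delta> + A\<close>; each of the six remaining terms is a small multiple of
    \<open>N\<close>.\<close>
  have eq: "\<rho> * \<rho>' - (1 + 4 * \<epsilon> - 16 * \<delta>^2) = (A - 2 * \<epsilon> - \<delta>^2) + (B - 2 * \<epsilon> - \<delta>^2)
     - 2 * ((a^2 - 9) * \<delta>^2) - 2 * ((a * \<delta>) * A) - (a * \<delta>) * m^2 + m * B"
    unfolding r'm rm m_def by (simp add: power2_eq_square algebra_simps)
  have "a^2 - 9 = (a - 3) * (a + 3)" by (simp add: power2_eq_square algebra_simps)
  hence "\<bar>a^2 - 9\<bar> = (a - 3) * (a + 3)" using a by (simp add: abs_mult)
  also have "\<dots> \<le> (1/1000) * 7" using a by (intro mult_mono) auto
  finally have t1: "\<bar>(a^2 - 9) * \<delta>^2\<bar> \<le> 7/1000 * N" unfolding abs_mult using N by (intro mult_mono) auto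
  have ad': "\<bar>a * \<delta>\<bar> \<le> 4/10000" using ad d by argo
  have t2: "\<bar>(a * \<delta>) * A\<bar> \<le> (4/10000) * (3 * N)" unfolding abs_mult[of "a * \<delta>"] using ad' A by (intro mult_mono) auto
  have "\<bar>m\<bar> \<le> 31/10 * \<bar>\<delta>\<bar> + 3 * N"
    using abs_triangle_ineq[of "a * \<delta>" A] ad A(1) unfolding m_def by argo
  hence "m^2 \<le> (31/10 * \<bar>\<delta>\<bar> + 3 * N)^2" by (metis abs_ge_zero power2_abs power_mono)
  also have "\<dots> \<le> 2 * (31/10 * \<bar>\<delta>\<bar>)^2 + 2 * (3 * N)^2"
    using zero_le_power2[of "31/10 * \<bar>\<delta>\<bar> - 3 * N"] by (simp add: power2_eq_square algebra_simps)
  also have "\<dots> = 2 * (31/10)^2 * \<delta>^2 + 18 * (N * N)" by (simp add: power_mult_distrib) (simp add: power2_eq_square)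
  also have "N * N \<le> 1 * N" using N by (intro mult_right_mono) auto
  finally have m2: "m^2 \<le> 40 * N" using N by (simp add: power2_eq_square)
  have t3: "\<bar>(a * \<delta>) * m^2\<bar> \<le> (4/10000) * (40 * N)" unfolding abs_mult[of "a * \<delta>"] using ad' m2 N by (intro mult_mono) auto
  have t4: "\<bar>m * B\<bar> \<le> (4/10000) * (4 * N)" unfolding abs_mult using m B2 by (intro mult_mono) auto
  have tri: "\<bar>b1 + b2 - 2 * b3 - 2 * b4 - b5 + b6\<bar>
      \<le> \<bar>b1\<bar> + \<bar>b2\<bar> + 2 * \<bar>b3\<bar> + 2 * \<bar>b4\<bar> + \<bar>b5\<bar> + \<bar>b6\<bar>" for b1 b2 b3 b4 b5 b6 :: real
    by simp
  have "\<bar>\<rho> * \<rho>' - (1 + 4 * \<epsilon> - 16 * \<delta>^2)\<bar> \<le> N / 10"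
    unfolding eq by (rule order_trans[OF tri]) (use A(2) B1 t1 t2 t3 t4 N(1) in argo)
  thus "\<bar>\<rho> * \<rho>' - (1 + 4 * \<epsilon> - 16 * \<delta>^2)\<bar> \<le> (\<bar>\<epsilon>\<bar> + \<delta>^2) / 10" unfolding N_def .
qed
lemma one_step_multiplier:
  fixes a \<rho> \<delta> \<epsilon> E :: real
  assumes a: "3 \<le> a" "a \<le> 3 + 1/1000"
    and r: "\<rho> = 1 + 2 * \<epsilon> + a * \<delta> + \<delta>^2 + E" and E: "\<bar>E\<bar> \<le> (\<bar>\<epsilon>\<bar> + \<delta>^2) / 1000"
    and d: "\<bar>\<delta>\<bar> \<le> 1/10000" and e: "\<bar>\<epsilon>\<bar> \<le> 1/100000000"
  shows "\<bar>\<rho> - 1\<bar> \<le> 1/1000"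
proof -
  have "\<delta>^2 = \<bar>\<delta>\<bar> * \<bar>\<delta>\<bar>" by (simp add: power2_eq_square)
  hence dd: "0 \<le> \<delta>^2" "\<delta>^2 \<le> (1/10000) * (1/10000)" using mult_mono[OF d d] by simp_all
  have "\<bar>a * \<delta>\<bar> \<le> (3 + 1/1000) * (1/10000)" unfolding abs_mult using a d by (intro mult_mono) auto
  moreover have "\<bar>E\<bar> \<le> 1/10000" using E dd e by argo
  ultimately have "\<bar>2 * \<epsilon> + a * \<delta> + \<delta>^2 + E\<bar> \<le> 1/1000" using e dd unfolding abs_le_iff by argo
  thus ?thesis unfolding r by (simp add: algebra_simps)
qed

text \<open>Passes from the multiplier of \<delta> to that of \<open>u = \<delta>^2\<close>, using
  \<open>Z^2 = 1 + 2 * (Z - 1) + (Z - 1)^2\<close> with the last term negligible.\<close>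

lemma square_multiplier:
  fixes Z u \<epsilon> :: real
  assumes Z: "\<bar>Z - (1 + 4 * \<epsilon> - 16 * u)\<bar> \<le> (\<bar>\<epsilon>\<bar> + u) / 10"
    and u: "0 \<le> u" "u \<le> 1/100000000" and e: "\<bar>\<epsilon>\<bar> \<le> 1/100000000"
  shows "\<bar>Z^2 - (1 + 8 * \<epsilon> - 32 * u)\<bar> \<le> (\<bar>\<epsilon>\<bar> + u) / 2"
proof -
  define N where "N = \<bar>\<epsilon>\<bar> + u"
  have N: "- N \<le> \<epsilon> + u" "\<epsilon> + u \<le> N" "\<epsilon> - u \<le> N" "- N \<le> \<epsilon> - u" "0 \<le> N" "N \<le> 1/1000"
    using u e unfolding N_def by simp_all
  have Z': "Z - (1 + 4 * \<epsilon> - 16 * u) \<le> N / 10" "- (Z - (1 + 4 * \<epsilon> - 16 * u)) \<le> N / 10"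
    using Z unfolding N_def abs_le_iff by simp_all
  have z: "\<bar>Z - 1\<bar> \<le> 17 * N"
    by (rule abs_leI) (use Z' N u in linarith)+
  have "\<bar>(Z - 1)^2\<bar> \<le> (17 * N) * (17/1000)"
    unfolding power2_eq_square abs_mult using z N by (intro mult_mono) auto
  hence "\<bar>Z^2 - 1 - 2 * (Z - 1)\<bar> \<le> (17 * N) * (17/1000)" by (simp add: power2_eq_square algebra_simps)
  hence "\<bar>Z^2 - (1 + 8 * \<epsilon> - 32 * u)\<bar> \<le> N / 2"
    using Z' N unfolding abs_le_iff by auto
  thus ?thesis unfolding N_def .
qed

text \<open>The primed values are those two steps of gradient descent later.\<close>

definition slow_fast_step :: "real \<Rightarrow> real \<Rightarrow> real \<Rightarrow> real \<Rightarrow> real \<Rightarrow> bool" where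
  "slow_fast_step \<eta> u \<epsilon> u' \<epsilon>' \<longleftrightarrow>
     \<bar>u' - u * (1 + 8 * \<epsilon> - 32 * u)\<bar> \<le> u * ((\<bar>\<epsilon>\<bar> + u) / 2) \<and>
     \<epsilon> - 9 * \<eta>^2 * u \<le> \<epsilon>' \<and> \<epsilon>' \<le> \<epsilon> - 7 * \<eta>^2 * u"

text \<open>\<open>excess\<close> is \<open>\<eta>/2\<close> times the sharpness, minus 1, at the minimum with the same \<open>x\<^sup>2 - y\<^sup>2\<close>.\<close>

definition excess :: "real \<Rightarrow> real \<Rightarrow> real \<Rightarrow> real" where
  "excess \<eta> x y = \<eta> * sqrt ((x^2 - y^2)^2 + 4) - 1"

text \<open>The balance \<open>x^2 - y^2\<close> is multiplied by \<open>1 - m\<close> with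
  \<open>m = \<eta>^2 * q^2 * r^2\<close>. Since \<open>r\<close> is about
  \<open>2 * \<delta>\<close>, \<open>m\<close> is about \<open>4 * \<eta>^2 * \<delta>^2\<close>,
  and \<open>one_step_balance\<close> gives the drop of the excess. As \<open>1 - m\<close> is
  positive, the order \<open>y < x\<close> persists.\<close>

lemma gd_step:
  fixes x y \<eta> :: real
  defines "r \<equiv> x^2 * y^2 - 1" and "\<delta> \<equiv> x * y - 1" and "\<epsilon> \<equiv> excess \<eta> x y"
  defines "x' \<equiv> x - \<eta> * x * y^2 * r" and "y' \<equiv> y - \<eta> * x^2 * y * r"
  assumes eta: "0 < \<eta>" "\<eta> \<le> 1/1000000000" and pos: "0 < y" "y < x"
    and d: "\<bar>\<delta>\<bar> \<le> 2/10000" and e: "\<bar>\<epsilon>\<bar> \<le> 2/100000000"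
  shows "\<exists>\<rho>. x' * y' - 1 = - \<rho> * \<delta> \<and>
     \<bar>\<rho> - (1 + 2 * \<epsilon> + (3 + 4 * \<eta>^2) * \<delta> + \<delta>^2)\<bar> \<le> (\<bar>\<epsilon>\<bar> + \<delta>^2) / 1000"
    and "\<epsilon> - 41/10 * (\<eta>^2 * \<delta>^2) \<le> excess \<eta> x' y'" "excess \<eta> x' y' \<le> \<epsilon> - 39/10 * (\<eta>^2 * \<delta>^2)"
    and "0 < y'" "y' < x'"
proof -
  define q where "q = x * y"
  \<comment> \<open>\<open>s\<close> is the value that \<sigma> takes at the minimum with the same
    \<open>x^2 - y^2\<close>.\<close>
  define s where "s = \<eta> * sqrt ((x^2 - y^2)^2 + 4)"
  define \<sigma> where "\<sigma> = \<eta> * (x^2 + y^2)"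
  define m where "m = \<eta>^2 * q^2 * r^2"
  have q: "q = 1 + \<delta>" and r: "r = q^2 - 1" and s: "s = 1 + \<epsilon>"
    unfolding q_def \<delta>_def r_def s_def \<epsilon>_def excess_def by (simp_all add: power_mult_distrib)
  have s2: "s^2 = \<eta>^2 * ((x^2 - y^2)^2 + 4)" unfolding s_def by (simp add: power_mult_distrib)
  have sig: "\<sigma>^2 - s^2 = 4 * \<eta>^2 * (q^2 - 1)" unfolding s2 \<sigma>_def q_def
    by (simp add: power2_eq_square algebra_simps)
  have sig0: "\<sigma> \<ge> 0" unfolding \<sigma>_def using eta by simp
  have eta2: "\<eta>^2 \<le> 1/1000000000"
    using power_mono[of \<eta> "1/1000000000" 2] eta by (simp add: power2_eq_square)
  have d2: "0 \<le> \<delta>^2" "\<delta>^2 \<le> 4/100000000"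
    using mult_mono[OF d d] by (simp_all add: power2_eq_square abs_mult_self_eq)
  have xy': "x' * y' = q * (1 - \<sigma> * (q^2 - 1) + \<eta>^2 * q^2 * (q^2 - 1)^2)"
    unfolding x'_def y'_def r q_def \<sigma>_def by (simp add: power2_eq_square algebra_simps)
  show "\<exists>\<rho>. x' * y' - 1 = - \<rho> * \<delta> \<and>
     \<bar>\<rho> - (1 + 2 * \<epsilon> + (3 + 4 * \<eta>^2) * \<delta> + \<delta>^2)\<bar> \<le> (\<bar>\<epsilon>\<bar> + \<delta>^2) / 1000"
    unfolding xy' by (rule gd_ratio[OF eta q s sig sig0 d e])
  have r3: "r = \<delta> * (2 + \<delta>)" unfolding r q by (simp add: power2_eq_square algebra_simps)
  have dd: "- 2/10000 \<le> \<delta>" "\<delta> \<le> 2/10000" using d by linarith+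
  have "\<bar>r\<bar> \<le> (2/10000) * 3" unfolding r3 abs_mult using d by (intro mult_mono) auto
  hence rb: "\<bar>r\<bar> \<le> 6/10000" by simp
  define c where "c = (2 + 3 * \<delta> + \<delta>^2)^2"
  have mc: "m = (\<eta>^2 * \<delta>^2) * c" unfolding m_def r3 q c_def by (simp add: power2_eq_square algebra_simps)
  have "2 + 3 * \<delta> + \<delta>^2 \<ge> 1999/1000" "2 + 3 * \<delta> + \<delta>^2 \<le> 2001/1000" using dd d2 by linarith+
  hence "(1999/1000)^2 \<le> c" "c \<le> (2001/1000)^2" unfolding c_def by (intro power_mono; simp)+
  hence c: "398/100 \<le> c" "c \<le> 402/100" by (simp_all add: power2_eq_square)
  define g where "g = \<eta>^2 * \<delta>^2"
  have g: "0 \<le> g" unfolding g_def by simp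
  have "g \<le> (1/1000000000) * 1" unfolding g_def using eta2 d2 by (intro mult_mono) auto
  hence g1: "g \<le> 1/1000000000" by simp
  have m: "398/100 * g \<le> m" "m \<le> 402/100 * g"
    unfolding mc g_def[symmetric] using g c mult_left_mono[OF c(1) g] mult_left_mono[OF c(2) g] by simp_all
  have s': "excess \<eta> x' y' + 1 = \<eta> * sqrt (((x^2 - y^2) * (1 - m))^2 + 4)"
  proof -
    have "x'^2 - y'^2 = (x^2 - y^2) * (1 - m)"
      unfolding x'_def y'_def m_def q_def by (simp add: power2_eq_square algebra_simps)
    thus ?thesis unfolding excess_def by simp
  qed
  have m1: "0 \<le> m" "m \<le> 1/1000" using m g g1 by linarith+
  have s1: "\<bar>s - 1\<bar> \<le> 1/1000" using e unfolding s by simp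
  note bal = one_step_balance[OF eta m1 s_def s' s1]
  show "\<epsilon> - 41/10 * (\<eta>^2 * \<delta>^2) \<le> excess \<eta> x' y'" "excess \<eta> x' y' \<le> \<epsilon> - 39/10 * (\<eta>^2 * \<delta>^2)"
    using bal m g unfolding s g_def[symmetric] by argo+
  have "s \<le> 1001/1000" "0 \<le> s" using s1 by linarith+
  hence "s^2 \<le> (1001/1000)^2" by (intro power_mono) auto
  moreover have "q^2 - 1 \<le> 1" using rb unfolding r by linarith
  hence "4 * \<eta>^2 * (q^2 - 1) \<le> 4 * \<eta>^2 * 1" by (intro mult_left_mono) auto
  ultimately have "\<sigma>^2 \<le> 2^2" using sig eta2 by (simp add: power2_eq_square)
  hence sb: "\<sigma> \<le> 2" by (rule power2_le_imp_le) simp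
  \<comment> \<open>Each coordinate is multiplied by such a factor, with \<open>z\<close> the square
    of the other coordinate.\<close>
  have fac: "0 < 1 - \<eta> * z * r" if "0 \<le> z" "z \<le> x^2 + y^2" for z
  proof -
    have "\<eta> * z \<le> \<sigma>" unfolding \<sigma>_def using that eta by (intro mult_left_mono) auto
    hence "\<bar>\<eta> * z * r\<bar> \<le> 2 * (6/10000)"
      unfolding abs_mult[of _ r] using rb sb that eta by (intro mult_mono) auto
    thus ?thesis by linarith
  qed
  have "x' = x * (1 - \<eta> * y^2 * r)" "y' = y * (1 - \<eta> * x^2 * r)"
    unfolding x'_def y'_def by (simp_all add: algebra_simps)
  hence "0 < x'" and y': "0 < y'" using fac[of "x^2"] fac[of "y^2"] pos by simp_all
  show "0 < y'" by fact
  have "y'^2 < x'^2"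
  proof -
    have "y^2 < x^2" using pos by (intro power_strict_mono) auto
    hence "0 < (x^2 - y^2) * (1 - m)" using m1 by simp
    also have "\<dots> = x'^2 - y'^2"
      unfolding x'_def y'_def m_def q_def by (simp add: power2_eq_square algebra_simps)
    finally show ?thesis by simp
  qed
  thus "y' < x'" by (rule power2_less_imp_less) (use \<open>0 < x'\<close> in simp)
qed

section \<open>One and two steps along a trajectory\<close>

lemma gd_trajectory_step:
  fixes x y :: "nat \<Rightarrow> real" and \<eta> :: real
  assumes gd: "gd_trajectory \<eta> x y"
    and eta: "0 < \<eta>" "\<eta> \<le> 1/1000000000" and pos: "0 < y t" "y t < x t"
    and d: "\<bar>x t * y t - 1\<bar> \<le> 2/10000" and e: "\<bar>excess \<eta> (x t) (y t)\<bar> \<le> 2/100000000"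
  shows "\<exists>\<rho>. x (Suc t) * y (Suc t) - 1 = - \<rho> * (x t * y t - 1) \<and>
     \<bar>\<rho> - (1 + 2 * excess \<eta> (x t) (y t) + (3 + 4 * \<eta>^2) * (x t * y t - 1) + (x t * y t - 1)^2)\<bar>
       \<le> (\<bar>excess \<eta> (x t) (y t)\<bar> + (x t * y t - 1)^2) / 1000"
    and "excess \<eta> (x t) (y t) - 41/10 * (\<eta>^2 * (x t * y t - 1)^2) \<le> excess \<eta> (x (Suc t)) (y (Suc t))"
    and "excess \<eta> (x (Suc t)) (y (Suc t)) \<le> excess \<eta> (x t) (y t) - 39/10 * (\<eta>^2 * (x t * y t - 1)^2)"
    and "0 < y (Suc t)" "y (Suc t) < x (Suc t)"
proof -
  have step: "x (Suc t) = x t - \<eta> * x t * (y t)^2 * ((x t)^2 * (y t)^2 - 1)"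
    "y (Suc t) = y t - \<eta> * (x t)^2 * y t * ((x t)^2 * (y t)^2 - 1)"
    using gd unfolding gd_trajectory_def by blast+
  note res = gd_step[OF eta pos d e, folded step]
  show "\<exists>\<rho>. x (Suc t) * y (Suc t) - 1 = - \<rho> * (x t * y t - 1) \<and>
     \<bar>\<rho> - (1 + 2 * excess \<eta> (x t) (y t) + (3 + 4 * \<eta>^2) * (x t * y t - 1) + (x t * y t - 1)^2)\<bar>
       \<le> (\<bar>excess \<eta> (x t) (y t)\<bar> + (x t * y t - 1)^2) / 1000"
    and "excess \<eta> (x t) (y t) - 41/10 * (\<eta>^2 * (x t * y t - 1)^2) \<le> excess \<eta> (x (Suc t)) (y (Suc t))"
    and "excess \<eta> (x (Suc t)) (y (Suc t)) \<le> excess \<eta> (x t) (y t) - 39/10 * (\<eta>^2 * (x t * y t - 1)^2)"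
    and "0 < y (Suc t)" "y (Suc t) < x (Suc t)"
    by (rule res)+
qed

text \<open>\<open>gd_trajectory_step\<close> allows twice the bounds assumed here, so it applies
  again at the intermediate point. The claims about \<open>Suc t\<close> later carry limits from
  even to odd times.\<close>

lemma gd_two_steps:
  fixes x y :: "nat \<Rightarrow> real" and \<eta> :: real
  defines "\<delta> \<equiv> \<lambda>t. x t * y t - 1" and "\<epsilon> \<equiv> \<lambda>t. excess \<eta> (x t) (y t)"
  assumes gd: "gd_trajectory \<eta> x y"
    and eta: "0 < \<eta>" "\<eta> \<le> 1/1000000000" and pos: "0 < y t" "y t < x t"
    and u: "(\<delta> t)^2 \<le> 1/100000000" and e: "\<bar>\<epsilon> t\<bar> \<le> 1/100000000"
  shows "slow_fast_step \<eta> ((\<delta> t)^2) (\<epsilon> t) ((\<delta> (Suc (Suc t)))^2) (\<epsilon> (Suc (Suc t)))"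
    and "\<bar>\<delta> (Suc t)\<bar> \<le> 2 * \<bar>\<delta> t\<bar>" "\<epsilon> (Suc t) \<le> \<epsilon> t" "\<epsilon> (Suc (Suc t)) \<le> \<epsilon> (Suc t)"
    and "0 < y (Suc t)" "y (Suc t) < x (Suc t)"
    and "0 < y (Suc (Suc t))" "y (Suc (Suc t)) < x (Suc (Suc t))"
proof -
  have "\<bar>\<delta> t\<bar>^2 \<le> (1/10000)^2" using u by (simp add: power2_eq_square)
  hence d: "\<bar>\<delta> t\<bar> \<le> 1/10000" by (rule power2_le_imp_le) simp
  have d1: "\<bar>\<delta> t\<bar> \<le> 2/10000" and e1: "\<bar>\<epsilon> t\<bar> \<le> 2/100000000" using d e by simp_all
  note one = gd_trajectory_step[OF gd eta pos d1[unfolded \<delta>_def] e1[unfolded \<epsilon>_def]]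
  define a where "a = 3 + 4 * \<eta>^2"
  have eta2: "0 \<le> \<eta>^2" "\<eta>^2 \<le> 1/1000000000"
    using power_mono[of \<eta> "1/1000000000" 2] eta by (simp_all add: power2_eq_square)
  have a: "3 \<le> a" "a \<le> 3 + 1/1000" unfolding a_def using eta2 by simp_all
  obtain \<rho> where \<rho>: "\<delta> (Suc t) = - \<rho> * \<delta> t"
    "\<bar>\<rho> - (1 + 2 * \<epsilon> t + a * \<delta> t + (\<delta> t)^2)\<bar> \<le> (\<bar>\<epsilon> t\<bar> + (\<delta> t)^2) / 1000"
    using one(1) unfolding \<delta>_def \<epsilon>_def a_def by blast
  define E where "E = \<rho> - (1 + 2 * \<epsilon> t + a * \<delta> t + (\<delta> t)^2)"
  have \<rho>E: "\<rho> = 1 + 2 * \<epsilon> t + a * \<delta> t + (\<delta> t)^2 + E" unfolding E_def by simp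
  have r1: "\<bar>\<rho> - 1\<bar> \<le> 1/1000"
    by (rule one_step_multiplier[OF a \<rho>E \<rho>(2)[folded E_def] d e])
  define u where "u = (\<delta> t)^2"
  have u0: "0 \<le> u" "u \<le> 1/100000000" using \<open>(\<delta> t)^2 \<le> _\<close> unfolding u_def by simp_all
  have "\<bar>\<delta> (Suc t)\<bar> = \<bar>\<rho>\<bar> * \<bar>\<delta> t\<bar>" unfolding \<rho>(1) by (simp add: abs_mult)
  also have "\<dots> \<le> 2 * \<bar>\<delta> t\<bar>" using r1 by (intro mult_right_mono) linarith+
  finally show d': "\<bar>\<delta> (Suc t)\<bar> \<le> 2 * \<bar>\<delta> t\<bar>" .
  define h where "h = \<eta>^2 * u"
  have h: "0 \<le> h" "h \<le> u / 10000" unfolding h_def using u0 eta2 mult_right_mono[OF eta2(2) u0(1)] by simp_all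
  have e': "\<epsilon> t - 41/10 * h \<le> \<epsilon> (Suc t)" "\<epsilon> (Suc t) \<le> \<epsilon> t - 39/10 * h"
    using one(2,3) unfolding h_def u_def \<epsilon>_def \<delta>_def by auto
  show "\<epsilon> (Suc t) \<le> \<epsilon> t" using e' h by linarith
  have pos': "0 < y (Suc t)" "y (Suc t) < x (Suc t)" using one(4,5) by auto
  thus "0 < y (Suc t)" "y (Suc t) < x (Suc t)" by auto
  have d2: "\<bar>\<delta> (Suc t)\<bar> \<le> 2/10000" using d d' by linarith
  have e2: "\<bar>\<epsilon> (Suc t)\<bar> \<le> 2/100000000"
  proof -
    have "- (1/100000000) \<le> \<epsilon> t" "\<epsilon> t \<le> 1/100000000" using e by linarith+
    thus ?thesis using e' h u0 by (intro abs_leI) linarith+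
  qed
  note two = gd_trajectory_step[OF gd eta pos' d2[unfolded \<delta>_def] e2[unfolded \<epsilon>_def]]
  show "0 < y (Suc (Suc t))" "y (Suc (Suc t)) < x (Suc (Suc t))" using two(4,5) by auto
  obtain \<rho>' where \<rho>': "\<delta> (Suc (Suc t)) = - \<rho>' * \<delta> (Suc t)"
    "\<bar>\<rho>' - (1 + 2 * \<epsilon> (Suc t) + a * \<delta> (Suc t) + (\<delta> (Suc t))^2)\<bar> \<le> (\<bar>\<epsilon> (Suc t)\<bar> + (\<delta> (Suc t))^2) / 1000"
    using two(1) unfolding \<delta>_def \<epsilon>_def a_def by blast
  define E' where "E' = \<rho>' - (1 + 2 * \<epsilon> (Suc t) + a * \<delta> (Suc t) + (\<delta> (Suc t))^2)"
  have \<rho>E': "\<rho>' = 1 + 2 * \<epsilon> (Suc t) + a * (- \<rho> * \<delta> t) + (- \<rho> * \<delta> t)^2 + E'"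
    unfolding E'_def \<rho>(1) by simp
  have ee: "\<bar>\<epsilon> (Suc t) - \<epsilon> t\<bar> \<le> (\<delta> t)^2 / 1000"
    unfolding u_def[symmetric] using e' h u0 by (intro abs_leI) linarith+
  have Z: "\<bar>\<rho> * \<rho>' - (1 + 4 * \<epsilon> t - 16 * u)\<bar> \<le> (\<bar>\<epsilon> t\<bar> + u) / 10"
    unfolding u_def
    by (rule two_step_multiplier[OF a \<rho>E \<rho>(2)[folded E_def] \<rho>E' \<rho>'(2)[folded E'_def, unfolded \<rho>(1)] ee d e])
  have u2: "(\<delta> (Suc (Suc t)))^2 = u * (\<rho> * \<rho>')^2" unfolding \<rho>'(1) \<rho>(1) u_def by (simp add: power2_eq_square)
  have "\<bar>(\<delta> (Suc (Suc t)))^2 - u * (1 + 8 * \<epsilon> t - 32 * u)\<bar> = u * \<bar>(\<rho> * \<rho>')^2 - (1 + 8 * \<epsilon> t - 32 * u)\<bar>"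
    unfolding u2 right_diff_distrib[symmetric] abs_mult using u0 by simp
  also have "\<dots> \<le> u * ((\<bar>\<epsilon> t\<bar> + u) / 2)"
    by (intro mult_left_mono square_multiplier[OF Z u0 e] u0)
  finally have A: "\<bar>(\<delta> (Suc (Suc t)))^2 - u * (1 + 8 * \<epsilon> t - 32 * u)\<bar> \<le> u * ((\<bar>\<epsilon> t\<bar> + u) / 2)" .
  define h' where "h' = \<eta>^2 * (\<delta> (Suc t))^2"
  have h'h: "h' = h * \<rho>^2" unfolding h'_def h_def u_def \<rho>(1) by (simp add: power_mult_distrib)
  have "(999/1000)^2 \<le> \<rho>^2" "\<rho>^2 \<le> (1001/1000)^2" using r1 by (intro power_mono; linarith)+
  hence "9/10 \<le> \<rho>^2" "\<rho>^2 \<le> 11/10" by (simp_all add: power2_eq_square)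
  from this[THEN mult_left_mono, OF h(1)] have h': "9/10 * h \<le> h'" "h' \<le> 11/10 * h"
    unfolding h'h by (simp_all add: mult.commute)
  have e'': "\<epsilon> (Suc t) - 41/10 * h' \<le> \<epsilon> (Suc (Suc t))" "\<epsilon> (Suc (Suc t)) \<le> \<epsilon> (Suc t) - 39/10 * h'"
    using two(2,3) unfolding h'_def \<epsilon>_def \<delta>_def by auto
  show "\<epsilon> (Suc (Suc t)) \<le> \<epsilon> (Suc t)" using e'' h' h by linarith
  \<comment> \<open>\<open>41/10 * (1 + 11/10)\<close> is below 9 and
    \<open>39/10 * (1 + 9/10)\<close> is above 7.\<close>
  have "\<epsilon> t - 9 * h \<le> \<epsilon> (Suc (Suc t))" "\<epsilon> (Suc (Suc t)) \<le> \<epsilon> t - 7 * h" using e' e'' h' h by linarith+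
  thus "slow_fast_step \<eta> ((\<delta> t)^2) (\<epsilon> t) ((\<delta> (Suc (Suc t)))^2) (\<epsilon> (Suc (Suc t)))"
    using A unfolding slow_fast_step_def u_def[symmetric] h_def by (simp add: mult.assoc)
qed

subsection \<open>Long-time behaviour of the two-step system\<close>

text \<open>With the sign of \<epsilon> fixed, the error \<open>u * (\<epsilon> + u) / 2\<close>
  merges into the coefficients 8 and \<open>- 32\<close>.\<close>

lemma slow_fast_above:
  assumes "slow_fast_step \<eta> u \<epsilon> u' \<epsilon>'" "0 \<le> \<epsilon>" "0 \<le> u"
  shows "u' \<le> u * (1 + 17/2 * \<epsilon> - 63/2 * u)" "u * (1 + 15/2 * \<epsilon> - 65/2 * u) \<le> u'"
  using assms unfolding slow_fast_step_def abs_le_iff by (auto simp: algebra_simps)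

lemma slow_fast_below:
  assumes "slow_fast_step \<eta> u \<epsilon> u' \<epsilon>'" "\<epsilon> \<le> 0" "0 \<le> u"
  shows "u' \<le> u * (1 + 15/2 * \<epsilon> - 63/2 * u)"
  using assms unfolding slow_fast_step_def abs_le_iff by (auto simp: algebra_simps)

section \<open>Confinement to a small box\<close>

lemma slow_fast_pos:
  assumes "slow_fast_step \<eta> u \<epsilon> u' \<epsilon>'" "0 < u" "u \<le> 1/100000000" "\<bar>\<epsilon>\<bar> \<le> 1/100000000"
  shows "0 < u'"
proof -
  have "u * (1 + 8 * \<epsilon> - 32 * u - (\<bar>\<epsilon>\<bar> + u) / 2) \<le> u'"
    using assms(1) unfolding slow_fast_step_def abs_le_iff by (auto simp: field_simps)
  moreover have "0 < u * (1 + 8 * \<epsilon> - 32 * u - (\<bar>\<epsilon>\<bar> + u) / 2)"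
    using assms(2-) by (intro mult_pos_pos) auto
  ultimately show ?thesis by linarith
qed

text \<open>The vertex of this parabola lies at \<open>1/63\<close> or beyond. Monotonicity allows
  \<open>u\<close> to be replaced by an upper bound in the estimates of one iteration.\<close>

lemma logistic_mono:
  fixes u v \<epsilon> :: real
  assumes "0 \<le> u" "u \<le> v" "v \<le> 1/1000" "0 \<le> \<epsilon>"
  shows "u * (1 + 17/2 * \<epsilon> - 63/2 * u) \<le> v * (1 + 17/2 * \<epsilon> - 63/2 * v)"
proof -
  have "v * (1 + 17/2 * \<epsilon> - 63/2 * v) - u * (1 + 17/2 * \<epsilon> - 63/2 * u)
      = (v - u) * (1 + 17/2 * \<epsilon> - 63/2 * (u + v))" by (simp add: field_simps)
  also have "\<dots> \<ge> 0" using assms by (intro mult_nonneg_nonneg) auto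
  finally show ?thesis by simp
qed

lemma slow_fast_bounded:
  assumes st: "slow_fast_step \<eta> u \<epsilon> u' \<epsilon>'" and u: "0 \<le> u" "u \<le> 1/100000000" and e: "\<epsilon> \<le> 1/100000000"
    "- 1/100000000 \<le> \<epsilon>"
  shows "u' \<le> 1/100000000"
proof (cases "\<epsilon> \<ge> 0")
  case True
  have "u' \<le> u * (1 + 17/2 * \<epsilon> - 63/2 * u)" using slow_fast_above[OF st True u(1)] by simp
  also have "\<dots> \<le> (1/100000000) * (1 + 17/2 * \<epsilon> - 63/2 * (1/100000000))"
    using u True by (intro logistic_mono) auto
  also have "\<dots> \<le> (1/100000000) * 1" using e by (intro mult_left_mono) auto
  finally show ?thesis by simp
next
  case False
  have "u' \<le> u * (1 + 15/2 * \<epsilon> - 63/2 * u)" using slow_fast_below[OF st _ u(1)] False by simp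
  also have "\<dots> \<le> u * 1" using False u by (intro mult_left_mono) auto
  finally show ?thesis using u by simp
qed

text \<open>By monotonicity in \<open>u\<close> the worst case is the boundary \<open>u = v\<close>
  of the trap. There the decay \<open>63/2 * v = 63/4 * \<epsilon> + 63/2 * \<eta>^2\<close>
  outweighs both the growth \<open>17/2 * \<epsilon>\<close> and the motion
  \<open>9/2 * \<eta>^2\<close> of the boundary.\<close>

lemma trap_step:
  assumes st: "slow_fast_step \<eta> u \<epsilon> u' \<epsilon>'" and u: "0 \<le> u" and e: "0 \<le> \<epsilon>" "\<epsilon> \<le> 1/100000000"
    and eta: "\<eta>^2 \<le> 1/100000000" and trap: "u \<le> \<epsilon> / 2 + \<eta>^2"
  shows "u' \<le> \<epsilon>' / 2 + \<eta>^2"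
proof -
  define v where "v = \<epsilon> / 2 + \<eta>^2"
  have "u' - \<epsilon>' / 2 \<le> u * (1 + 17/2 * \<epsilon> - 63/2 * u) - (\<epsilon> - 9 * \<eta>^2 * u) / 2"
    using slow_fast_above(1)[OF st e(1) u] st unfolding slow_fast_step_def by (simp add: field_simps)
  also have "\<dots> \<le> v * (1 + 17/2 * \<epsilon> - 63/2 * v) - (\<epsilon> - 9 * \<eta>^2 * v) / 2"
  proof -
    have v: "v \<le> 1/1000" "u \<le> v" using e eta trap unfolding v_def by linarith+
    have "\<eta>^2 * u \<le> \<eta>^2 * v" using v by (intro mult_left_mono) auto
    moreover have "u * (1 + 17/2 * \<epsilon> - 63/2 * u) \<le> v * (1 + 17/2 * \<epsilon> - 63/2 * v)"
      using v u e by (intro logistic_mono) auto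
    ultimately show ?thesis by argo
  qed
  also have "\<dots> = \<eta>^2 + v * (17/2 * \<epsilon> - 63/2 * v + 9/2 * \<eta>^2)"
    unfolding v_def by (simp add: field_simps)
  also have "\<dots> \<le> \<eta>^2 + 0"
  proof (intro add_left_mono mult_nonneg_nonpos)
    show "0 \<le> v" using e unfolding v_def by simp
    show "17/2 * \<epsilon> - 63/2 * v + 9/2 * \<eta>^2 \<le> 0"
      using e(1) zero_le_power2[of \<eta>] unfolding v_def by argo
  qed
  finally show ?thesis by simp
qed

text \<open>Outside the trap \<epsilon> is at most \<open>2 * u\<close>, so the multiplier of
  \<open>u\<close> is at most \<open>1 - 27/2 * u\<close>. Since
  \<open>\<epsilon> / \<eta>^2\<close> falls by at most \<open>9 * u\<close>, the weight grows at
  most by \<open>exp (27/2 * u)\<close>, which balances this: \<open>27/2 = 3/2 * 9\<close>.\<close>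

lemma decay_step:
  assumes st: "slow_fast_step \<eta> u \<epsilon> u' \<epsilon>'" and u: "0 \<le> u" and e: "0 \<le> \<epsilon>"
    and eta: "0 < \<eta>" and out: "\<epsilon> / 2 + \<eta>^2 \<le> u"
  shows "u' * exp (- (3/2) * (\<epsilon>' / \<eta>^2)) \<le> u * exp (- (3/2) * (\<epsilon> / \<eta>^2))"
proof -
  have "u' \<le> u * (1 + 17/2 * \<epsilon> - 63/2 * u)" using slow_fast_above[OF st e u] by simp
  also have "\<dots> \<le> u * (1 + - (27/2) * u)"
    by (intro mult_left_mono u) (use out u zero_le_power2[of \<eta>] in linarith)
  also have "\<dots> \<le> u * exp (- (27/2) * u)"
    using u exp_ge_add_one_self[of "- (27/2) * u"] by (intro mult_left_mono) auto
  also have "\<dots> \<le> u * exp ((3/2) * (\<epsilon>' / \<eta>^2 - \<epsilon> / \<eta>^2))"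
  proof -
    have "(\<epsilon> - 9 * \<eta>^2 * u) / \<eta>^2 \<le> \<epsilon>' / \<eta>^2"
      using st unfolding slow_fast_step_def by (intro divide_right_mono) auto
    hence "\<epsilon> / \<eta>^2 - 9 * u \<le> \<epsilon>' / \<eta>^2" using eta by (simp add: diff_divide_distrib)
    thus ?thesis using u by (intro mult_left_mono) auto
  qed
  finally have "u' * exp (- (3/2) * (\<epsilon>' / \<eta>^2))
      \<le> u * exp ((3/2) * (\<epsilon>' / \<eta>^2 - \<epsilon> / \<eta>^2)) * exp (- (3/2) * (\<epsilon>' / \<eta>^2))"
    by (intro mult_right_mono) auto
  also have "\<dots> = u * exp (- (3/2) * (\<epsilon> / \<eta>^2))"
    by (simp add: mult.assoc algebra_simps flip: exp_add)
  finally show ?thesis .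
qed

text \<open>\<open>\<epsilon> / \<eta>^2\<close> falls by at least \<open>7 * u\<close>, so the
  weight grows at least by \<open>exp (35 * u)\<close>, while \<open>u\<close> shrinks at most by
  the factor \<open>1 - 65/2 * u\<close>; 35 exceeds \<open>65/2\<close>, and for small
  \<open>u\<close> this margin covers the quadratic term.\<close>

lemma growth_step:
  assumes st: "slow_fast_step \<eta> u \<epsilon> u' \<epsilon>'" and u: "0 \<le> u" "u \<le> 1/100000000" and e: "0 \<le> \<epsilon>"
    and eta: "0 < \<eta>"
  shows "u * exp (- 5 * (\<epsilon> / \<eta>^2)) \<le> u' * exp (- 5 * (\<epsilon>' / \<eta>^2))"
proof -
  have "u * exp (5 * (\<epsilon>' / \<eta>^2 - \<epsilon> / \<eta>^2)) \<le> u * exp (- (35 * u))"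
  proof -
    have "\<epsilon>' / \<eta>^2 \<le> (\<epsilon> - 7 * \<eta>^2 * u) / \<eta>^2"
      using st unfolding slow_fast_step_def by (intro divide_right_mono) auto
    hence "\<epsilon>' / \<eta>^2 \<le> \<epsilon> / \<eta>^2 - 7 * u" using eta by (simp add: diff_divide_distrib)
    thus ?thesis using u by (intro mult_left_mono) auto
  qed
  also have "\<dots> \<le> u * (1 + 15/2 * \<epsilon> - 65/2 * u)"
  proof (intro mult_left_mono u)
    have "exp (- (35 * u)) \<le> 1 / (1 + 35 * u)"
      using exp_ge_add_one_self[of "35 * u"] u by (simp add: exp_minus field_simps)
    also have "\<dots> \<le> 1 - 65/2 * u"
    proof -
      have "1 \<le> (1 - 65/2 * u) * (1 + 35 * u)"
      proof -
        have "(1 - 65/2 * u) * (1 + 35 * u) - 1 = u * (5/2 - 2275/2 * u)" by (simp add: algebra_simps)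
        also have "\<dots> \<ge> 0" using u by (intro mult_nonneg_nonneg) auto
        finally show ?thesis by simp
      qed
      thus ?thesis using u by (simp add: pos_divide_le_eq)
    qed
    finally show "exp (- (35 * u)) \<le> 1 + 15/2 * \<epsilon> - 65/2 * u" using e by simp
  qed
  also have "\<dots> \<le> u'" using slow_fast_above[OF st e u(1)] by simp
  finally have "u * exp (5 * (\<epsilon>' / \<eta>^2 - \<epsilon> / \<eta>^2)) * exp (- 5 * (\<epsilon>' / \<eta>^2)) \<le> u' * exp (- 5 * (\<epsilon>' / \<eta>^2))"
    by (intro mult_right_mono) auto
  moreover have "u * exp (5 * (\<epsilon>' / \<eta>^2 - \<epsilon> / \<eta>^2)) * exp (- 5 * (\<epsilon>' / \<eta>^2)) = u * exp (- 5 * (\<epsilon> / \<eta>^2))"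
    by (simp add: mult.assoc algebra_simps flip: exp_add)
  ultimately show ?thesis by (simp only:)
qed

text \<open>The weight \<open>2/5\<close> makes the increase of \<open>\<epsilon>^2\<close> cost
  \<open>2/5 * 18 = 36/5\<close> in units of \<open>\<eta>^2 * u * (- \<epsilon>)\<close>, less than
  the gain \<open>15/2\<close> from the decay of \<open>u\<close>.\<close>

lemma lyapunov_step:
  assumes st: "slow_fast_step \<eta> u \<epsilon> u' \<epsilon>'" and u: "0 \<le> u" and e: "\<epsilon> \<le> 0"
    and eta: "0 < \<eta>" "\<eta>^2 \<le> 1/100000000"
  shows "\<eta>^2 * u' + 2/5 * \<epsilon>'^2 \<le> \<eta>^2 * u + 2/5 * \<epsilon>^2"
proof -
  have e': "\<epsilon> - 9 * \<eta>^2 * u \<le> \<epsilon>'" "\<epsilon>' \<le> 0"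
    using st e u unfolding slow_fast_step_def by auto
  have "\<epsilon>'^2 \<le> (\<epsilon> - 9 * \<eta>^2 * u)^2" using e' by (simp add: abs_le_square_iff[symmetric])
  also have "\<dots> = \<epsilon>^2 + \<eta>^2 * u * (- 18 * \<epsilon> + 81 * \<eta>^2 * u)" by (simp add: power2_eq_square algebra_simps)
  finally have "\<eta>^2 * u' + 2/5 * \<epsilon>'^2 \<le> \<eta>^2 * (u * (1 + 15/2 * \<epsilon> - 63/2 * u))
      + 2/5 * (\<epsilon>^2 + \<eta>^2 * u * (- 18 * \<epsilon> + 81 * \<eta>^2 * u))"
    using slow_fast_below[OF st e u] by (intro add_mono mult_left_mono) auto
  also have "\<dots> = \<eta>^2 * u + 2/5 * \<epsilon>^2 + \<eta>^2 * u * (3/10 * \<epsilon> + u * (162/5 * \<eta>^2 - 63/2))"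
    by (simp add: field_simps)
  also have "\<dots> \<le> \<eta>^2 * u + 2/5 * \<epsilon>^2 + 0"
  proof (intro add_left_mono mult_nonneg_nonpos)
    have "u * (162/5 * \<eta>^2 - 63/2) \<le> 0" using u eta by (intro mult_nonneg_nonpos) auto
    thus "3/10 * \<epsilon> + u * (162/5 * \<eta>^2 - 63/2) \<le> 0" using e by simp
  qed (use u in auto)
  finally show ?thesis by simp
qed

text \<open>The convex function on the left is largest at a corner of the triangle cut out by the
  assumptions; the value \<open>8/5 * h^2\<close> is attained at \<open>u = 0\<close>,
  \<open>\<epsilon> = - 2 * h\<close>. The same level later forces \<epsilon> to stay at or above
  \<open>- 2 * h\<close>.\<close>

lemma trap_crossing:
  fixes h u \<epsilon> :: real
  assumes "0 \<le> h" "0 \<le> u" "\<epsilon> \<le> 0" "u \<le> \<epsilon> / 2 + h"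
  shows "h * u + 2/5 * \<epsilon>^2 \<le> 8/5 * h^2"
proof -
  have a: "0 \<le> - \<epsilon>" "- \<epsilon> \<le> 2 * h" using assms by linarith+
  have "(- \<epsilon>) * (- \<epsilon>) \<le> (2 * h) * (- \<epsilon>)" using a by (intro mult_right_mono) auto
  moreover have "h * u \<le> h * (\<epsilon> / 2 + h)" using assms by (intro mult_left_mono) auto
  moreover have "h * (- \<epsilon>) \<le> h * (2 * h)" using a assms by (intro mult_left_mono) auto
  ultimately show ?thesis by (simp add: power2_eq_square algebra_simps)
qed

text \<open>Every time lies in one of three phases: before the trap, inside it with \<epsilon>
  nonnegative, or after \<epsilon> has become negative. \<open>P\<close> carries the side conditions
  under which an iteration is a \<open>slow_fast_step\<close>, and \<open>gap\<close> excludes that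
  \<epsilon> becomes negative before the trap is reached.\<close>

lemma slow_fast_limit:
  fixes u \<epsilon> :: "nat \<Rightarrow> real"
  assumes eta: "0 < \<eta>" "\<eta>^2 \<le> 1/1000000000"
    and P0: "P 0" and step: "\<And>n. \<lbrakk>P n; 0 < u n; u n \<le> 1/100000000; \<bar>\<epsilon> n\<bar> \<le> 1/100000000\<rbrakk>
      \<Longrightarrow> slow_fast_step \<eta> (u n) (\<epsilon> n) (u (Suc n)) (\<epsilon> (Suc n)) \<and> P (Suc n)"
    and u0: "0 < u 0" "u 0 \<le> 1/100000000" and e0: "0 \<le> \<epsilon> 0" "\<epsilon> 0 \<le> 1/100000000"
    and gap: "exp ((3/2) * (1 - \<epsilon> 0 / \<eta>^2)) \<le> \<eta>^2"
  shows "\<forall>n. P n \<and> 0 < u n \<and> u n \<le> 1/100000000 \<and> \<bar>\<epsilon> n\<bar> \<le> 1/100000000"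
    and "\<exists>L. - 2 * \<eta>^2 \<le> L \<and> L < 0 \<and> \<epsilon> \<longlonglongrightarrow> L \<and> u \<longlonglongrightarrow> 0"
proof -
  define pre where "pre n \<longleftrightarrow> 0 \<le> \<epsilon> n \<and> u n * exp (- (3/2) * (\<epsilon> n / \<eta>^2)) \<le> exp (- (3/2) * (\<epsilon> 0 / \<eta>^2))" for n
  define trapped where "trapped n \<longleftrightarrow> 0 \<le> \<epsilon> n \<and> u n \<le> \<epsilon> n / 2 + \<eta>^2" for n
  define crossed where "crossed n \<longleftrightarrow> \<epsilon> n < 0 \<and> \<eta>^2 * u n + 2/5 * (\<epsilon> n)^2 \<le> 8/5 * (\<eta>^2)^2" for n
  define Inv where "Inv n \<longleftrightarrow> P n \<and> 0 < u n \<and> u n \<le> 1/100000000 \<and> \<epsilon> n \<le> 1/100000000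
     \<and> (pre n \<or> trapped n \<or> crossed n)" for n
  \<comment> \<open>On the level \<open>8/5 * (\<eta>^2)^2\<close> the term
    \<open>2/5 * (\<epsilon> n)^2\<close> alone bounds \<epsilon> from below.\<close>
  have cr: "- 2 * \<eta>^2 \<le> \<epsilon> n" if "crossed n" "0 < u n" for n
  proof -
    have "0 \<le> \<eta>^2 * u n" using that by simp
    moreover have "(2 * \<eta>^2)^2 = 4 * (\<eta>^2)^2" by (simp only: power_mult_distrib) simp
    ultimately have "(- \<epsilon> n)^2 \<le> (2 * \<eta>^2)^2" using that(1) unfolding crossed_def power2_minus by argo
    hence "- \<epsilon> n \<le> 2 * \<eta>^2" by (rule power2_le_imp_le) simp
    thus ?thesis by simp
  qed
  have bnd: "\<bar>\<epsilon> n\<bar> \<le> 1/100000000" if "Inv n" for n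
    using that cr[of n] eta unfolding Inv_def pre_def trapped_def crossed_def by auto
  have st: "slow_fast_step \<eta> (u n) (\<epsilon> n) (u (Suc n)) (\<epsilon> (Suc n))" if "Inv n" for n
    using step[of n] bnd[OF that] that unfolding Inv_def by auto
  have dec: "\<epsilon> (Suc n) \<le> \<epsilon> n - 7 * \<eta>^2 * u n" "\<epsilon> n - 9 * \<eta>^2 * u n \<le> \<epsilon> (Suc n)" if "Inv n" for n
    using st[OF that] unfolding slow_fast_step_def by auto
  have anti: "\<epsilon> (Suc n) \<le> \<epsilon> n" if "Inv n" for n
  proof -
    have "0 \<le> 7 * \<eta>^2 * u n" using that unfolding Inv_def by simp
    thus ?thesis using dec(1)[OF that] by linarith
  qed
  have Inv: "Inv n" for n
  proof (induction n)
    case 0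
    have "u 0 * exp (- (3/2) * (\<epsilon> 0 / \<eta>^2)) \<le> 1 * exp (- (3/2) * (\<epsilon> 0 / \<eta>^2))"
      using u0 by (intro mult_right_mono) auto
    thus ?case using P0 u0 e0 unfolding Inv_def pre_def by simp
  next
    case (Suc n)
    have u: "0 < u n" "u n \<le> 1/100000000" and e: "\<epsilon> n \<le> 1/100000000" using Suc unfolding Inv_def by auto
    note s = st[OF Suc]
    have u': "0 < u (Suc n)" using slow_fast_pos[OF s u bnd[OF Suc]] .
    have b: "u (Suc n) \<le> 1/100000000" using slow_fast_bounded[OF s] u bnd[OF Suc] by auto
    have c: "\<epsilon> (Suc n) \<le> 1/100000000" using anti[OF Suc] e by simp
    have eta8: "\<eta>^2 \<le> 1/100000000" using eta by simp
    have tr: "trapped (Suc n) \<or> crossed (Suc n)" if "trapped n"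
    proof -
      have t: "u (Suc n) \<le> \<epsilon> (Suc n) / 2 + \<eta>^2"
        using trap_step[OF s] that u e eta8 unfolding trapped_def by auto
      show ?thesis
      proof (cases "0 \<le> \<epsilon> (Suc n)")
        case True thus ?thesis using t unfolding trapped_def by blast
      next
        case False
        thus ?thesis using trap_crossing[OF _ _ _ t] u' unfolding crossed_def by simp
      qed
    qed
    have "pre (Suc n) \<or> trapped (Suc n) \<or> crossed (Suc n)"
    proof -
      consider "trapped n" | "crossed n" | "pre n" "\<not> trapped n" using Suc unfolding Inv_def by auto
      thus ?thesis
      proof cases
        case 1 thus ?thesis using tr by blast
      next
        case 2
        hence "\<eta>^2 * u (Suc n) + 2/5 * (\<epsilon> (Suc n))^2 \<le> \<eta>^2 * u n + 2/5 * (\<epsilon> n)^2"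
          using u unfolding crossed_def by (intro lyapunov_step[OF s _ _ eta(1) eta8]) auto
        hence "crossed (Suc n)" using 2 anti[OF Suc] unfolding crossed_def by linarith
        thus ?thesis by blast
      next
        case 3
        hence ge: "0 \<le> \<epsilon> n" and out: "\<epsilon> n / 2 + \<eta>^2 \<le> u n"
          and p: "u n * exp (- (3/2) * (\<epsilon> n / \<eta>^2)) \<le> exp (- (3/2) * (\<epsilon> 0 / \<eta>^2))"
          unfolding pre_def trapped_def by auto
        \<comment> \<open>Outside the trap \<open>u n\<close> is at least \<open>\<eta>^2\<close>,
          hence at least the left side of \<open>gap\<close>. Against the decayed bound
          \<open>p\<close> this gives \<open>\<eta>^2 \<le> \<epsilon> n\<close>, and one iteration
          lowers \<epsilon> by at most \<open>9 * \<eta>^2 * u n\<close>, so \<epsilon> remains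
          nonnegative.\<close>
        have "exp ((3/2) * (1 - \<epsilon> 0 / \<eta>^2)) * exp (- (3/2) * (\<epsilon> n / \<eta>^2))
            \<le> u n * exp (- (3/2) * (\<epsilon> n / \<eta>^2))"
          using gap out ge by (intro mult_right_mono) auto
        hence "exp ((3/2) * (1 - \<epsilon> 0 / \<eta>^2) + - (3/2) * (\<epsilon> n / \<eta>^2)) \<le> exp (- (3/2) * (\<epsilon> 0 / \<eta>^2))"
          using p unfolding exp_add by linarith
        hence "1 \<le> \<epsilon> n / \<eta>^2" unfolding exp_le_cancel_iff by argo
        hence "\<eta>^2 \<le> \<epsilon> n" using eta by (simp add: field_simps)
        moreover have "9 * \<eta>^2 * u n \<le> 9 * \<eta>^2 * (1/9)" using u by (intro mult_left_mono) auto
        ultimately have "0 \<le> \<epsilon> (Suc n)" using dec(2)[OF Suc] by simp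
        moreover have "u (Suc n) * exp (- (3/2) * (\<epsilon> (Suc n) / \<eta>^2)) \<le> exp (- (3/2) * (\<epsilon> 0 / \<eta>^2))"
          using u by (intro order_trans[OF decay_step[OF s _ ge eta(1) out] p]) simp
        ultimately show ?thesis unfolding pre_def by blast
      qed
    qed
    moreover have "P (Suc n)" using step[of n] bnd[OF Suc] Suc unfolding Inv_def by auto
    ultimately show ?case using u' b c unfolding Inv_def by blast
  qed
  show "\<forall>n. P n \<and> 0 < u n \<and> u n \<le> 1/100000000 \<and> \<bar>\<epsilon> n\<bar> \<le> 1/100000000"
    using Inv bnd[OF Inv] unfolding Inv_def by blast
  have upos: "0 < u n" "u n \<le> 1/100000000" for n using Inv[of n] unfolding Inv_def by auto
  have decs: "decseq \<epsilon>" using anti[OF Inv] by (rule decseq_SucI)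
  have "\<exists>T. \<epsilon> T < 0"
  proof (rule ccontr)
    assume "\<nexists>T. \<epsilon> T < 0"
    hence nn: "0 \<le> \<epsilon> n" for n by (simp add: not_less)
    \<comment> \<open>If \<epsilon> stayed nonnegative, \<open>growth_step\<close> would keep
      \<open>u\<close> above \<open>c\<close>, and \<epsilon> would fall by at least the fixed
      amount \<open>7 * \<eta>^2 * c\<close> per iteration.\<close>
    define c where "c = u 0 * exp (- 5 * (\<epsilon> 0 / \<eta>^2))"
    have c: "c > 0" using u0 unfolding c_def by simp
    have "c \<le> u n * exp (- 5 * (\<epsilon> n / \<eta>^2))" for n
    proof (induction n)
      case (Suc n)
      also have "u n * exp (- 5 * (\<epsilon> n / \<eta>^2)) \<le> u (Suc n) * exp (- 5 * (\<epsilon> (Suc n) / \<eta>^2))"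
        using growth_step[OF st[OF Inv] _ upos(2) nn eta(1)] upos by (simp add: less_imp_le)
      finally show ?case .
    qed (simp add: c_def)
    moreover have "u n * exp (- 5 * (\<epsilon> n / \<eta>^2)) \<le> u n * 1" for n
      using upos[of n] nn[of n] by (intro mult_left_mono) auto
    ultimately have cu: "c \<le> u n" for n using order_trans by fastforce
    have "\<epsilon> n \<le> \<epsilon> 0 - n * (7 * \<eta>^2 * c)" for n
    proof (induction n)
      case (Suc n)
      have "7 * \<eta>^2 * c \<le> 7 * \<eta>^2 * u n" using cu by (intro mult_left_mono) auto
      thus ?case using Suc dec(1)[OF Inv, of n] by (simp add: algebra_simps)
    qed simp
    moreover obtain n :: nat where "\<epsilon> 0 < n * (7 * \<eta>^2 * c)"
      using reals_Archimedean3[of "7 * \<eta>^2 * c"] c eta by auto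
    moreover have "\<epsilon> n \<ge> 0" by (rule nn)
    ultimately show False using leD by (metis diff_ge_0_iff_ge order_trans)
  qed
  then obtain T where T: "\<epsilon> T < 0" ..
  have neg: "\<epsilon> n \<le> \<epsilon> T" if "T \<le> n" for n using decs that by (simp add: decseq_def)
  have low: "- 2 * \<eta>^2 \<le> \<epsilon> n" for n
  proof (cases "0 \<le> \<epsilon> n")
    case True
    thus ?thesis using zero_le_power2[of \<eta>] by linarith
  next
    case False
    thus ?thesis using cr[of n] Inv[of n] unfolding Inv_def pre_def trapped_def by blast
  qed
  then obtain L where L: "\<epsilon> \<longlonglongrightarrow> L" using decseq_convergent[OF decs allI[OF low]] by blast
  have L1: "- 2 * \<eta>^2 \<le> L" using low L by (intro LIMSEQ_le_const) auto
  have "L \<le> \<epsilon> T" using decseq_ge[OF decs L] .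
  hence L2: "L < 0" using T by simp
  \<comment> \<open>Since \<epsilon> decreases, \<open>k\<close> bounds every multiplier of
    \<open>u\<close> from time \<open>T\<close> on.\<close>
  define k where "k = 1 + 15/2 * \<epsilon> T"
  have k: "0 \<le> k" "k < 1" unfolding k_def using T bnd[OF Inv, of T] by auto
  have "u (n + T) \<le> k ^ n * u T" for n
  proof (induction n)
    case (Suc n)
    have "u (Suc (n + T)) \<le> u (n + T) * (1 + 15/2 * \<epsilon> (n + T) - 63/2 * u (n + T))"
      using slow_fast_below[OF st[OF Inv]] neg[of "n + T"] T upos(1)[of "n + T"] by simp
    also have "\<dots> \<le> u (n + T) * k"
      using upos(1)[of "n + T"] neg[of "n + T"] unfolding k_def by (intro mult_left_mono) auto
    also have "\<dots> \<le> (k ^ n * u T) * k" using Suc k by (intro mult_right_mono) auto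
    finally show ?case by (simp add: mult_ac)
  qed simp
  moreover have "(\<lambda>n. k ^ n * u T) \<longlonglongrightarrow> 0"
    using tendsto_mult_right[OF LIMSEQ_realpow_zero[OF k], of "u T"] by simp
  ultimately have "(\<lambda>n. u (n + T)) \<longlonglongrightarrow> 0"
    using upos(1) by (intro tendsto_sandwich[OF _ _ tendsto_const, of 0 "\<lambda>n. u (n + T)"]) (auto intro!: always_eventually less_imp_le)
  hence "u \<longlonglongrightarrow> 0" by (rule LIMSEQ_offset)
  with L1 L2 L show "\<exists>L. - 2 * \<eta>^2 \<le> L \<and> L < 0 \<and> \<epsilon> \<longlonglongrightarrow> L \<and> u \<longlonglongrightarrow> 0" by blast
qed

subsection \<open>Initialization and conclusion\<close>

text \<open>\<open>(1 / \<eta> + R) * (1 / \<eta> - R) = 4\<close>, so the two halves are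
  reciprocal. Their sum \<open>1 / \<eta>\<close> encodes sharpness \<open>2 / \<eta>\<close>, and
  their difference \<open>R\<close> is the balance of this minimum.\<close>

lemma x_eos_squares:
  assumes eta: "0 < \<eta>" "\<eta> \<le> 1/2"
  defines "R \<equiv> sqrt (1 / \<eta>^2 - 4)"
  shows "(x_eos \<eta>)^2 = (1 / \<eta> + R) / 2" "1 / (x_eos \<eta>)^2 = (1 / \<eta> - R) / 2"
    and "0 < x_eos \<eta>" "R^2 = 1 / \<eta>^2 - 4"
proof -
  have "\<eta>^2 \<le> (1/2)^2" using eta by (intro power_mono) auto
  hence nn: "0 \<le> 1 / \<eta>^2 - 4" using eta by (simp add: field_simps)
  show R2: "R^2 = 1 / \<eta>^2 - 4" unfolding R_def using nn by simp
  have R0: "0 \<le> R" unfolding R_def using nn by simp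
  hence p: "0 < 1 / \<eta> + R" using eta by (intro add_pos_nonneg) auto
  show X: "(x_eos \<eta>)^2 = (1 / \<eta> + R) / 2"
    using p unfolding x_eos_def R_def[symmetric] by (simp add: power_mult_distrib power_divide)
  have "(1 / \<eta> + R) * (1 / \<eta> - R) = 4"
    using R2 by (simp add: algebra_simps power2_eq_square)
  moreover have "1 / (A / 2) = B / 2" if "A * B = 4" for A B :: real
    using that by (cases "A = 0") (auto simp: field_simps)
  ultimately show "1 / (x_eos \<eta>)^2 = (1 / \<eta> - R) / 2" unfolding X by blast
  show "0 < x_eos \<eta>" using p unfolding x_eos_def R_def[symmetric] by (simp add: add.commute)
qed

text \<open>With \<open>a\<close> the fourth root of \<eta> all powers are integral.
  \<open>x_eos \<eta>\<close> is about \<open>1 / a^2\<close>, so exceeding it by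
  \<open>13 * a^5\<close> raises \<open>x^2\<close> by about \<open>26 * a^3\<close>. As
  \<open>D + R\<close> is about \<open>2 / \<eta>\<close>, \<open>s^2 - 1\<close> is then at least
  \<open>49 * a^7\<close>, and half of this leaves \<open>20 * a^7\<close> for the excess. The upper
  bound follows the same computation.\<close>

lemma initial_excess:
  fixes a \<kappa> x y \<eta> :: real
  assumes a: "0 < a" and eta: "\<eta> = a^4" "\<eta> \<le> \<kappa> / 8000000" and \<kappa>: "\<kappa> \<le> 1/100000000"
    and x: "x_eos \<eta> + 13 * a^5 < x" "x < x_eos \<eta> + 1/5 * \<kappa> * (1 / a^2)"
    and d: "\<bar>x * y - 1\<bar> \<le> 1/10000"
  shows "20 * a^7 \<le> excess \<eta> x y" "excess \<eta> x y \<le> \<kappa>" "0 < y" "y < x"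
proof -
  define X where "X = x_eos \<eta>"
  define R where "R = sqrt (1 / \<eta>^2 - 4)"
  define q where "q = x * y"
  define h where "h = x - X"
  have eta0: "0 < \<eta>" unfolding eta using a by simp
  have kap0: "0 < \<kappa>" using eta0 eta(2) by linarith
  have etas: "\<eta> \<le> 1/1000000000000" using eta(2) \<kappa> by linarith
  have "a^4 < 1^4" using eta etas by simp
  hence a1: "a < 1" using a by (rule_tac power_less_imp_less_base[of a 4]) auto
  note eos = x_eos_squares[OF eta0, folded X_def R_def]
  have X2: "X^2 = (1 / \<eta> + R) / 2" and Xi: "1 / X^2 = (1 / \<eta> - R) / 2" and X0: "0 < X"
    and R2: "R^2 = 1 / \<eta>^2 - 4" using eos etas by auto
  have nn: "0 \<le> 1 / \<eta>^2 - 4"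
  proof -
    have "\<eta>^2 \<le> (1/2)^2" using eta0 etas by (intro power_mono) auto
    thus ?thesis using eta0 by (simp add: field_simps)
  qed
  have R0: "0 \<le> R" unfolding R_def using nn by simp
  have R1: "R \<le> 1 / \<eta>"
  proof (rule power2_le_imp_le)
    show "R^2 \<le> (1 / \<eta>)^2" unfolding R2 by (simp add: power_divide)
  qed (use eta0 in simp)
  have Rl: "999/1000 / \<eta> \<le> R"
  proof (rule power2_le_imp_le[OF _ R0])
    have "\<eta>^2 \<le> (1/1000000000000)^2" using eta0 etas by (intro power_mono) auto
    hence "4 * \<eta>^2 \<le> 1/1000" by (simp add: power2_eq_square)
    hence "4 \<le> 1/1000 / \<eta>^2" using eta0 by (simp add: field_simps)
    hence "998001/1000000 / \<eta>^2 \<le> 1 / \<eta>^2 - 4" by (simp add: field_simps)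
    thus "(999/1000 / \<eta>)^2 \<le> R^2" unfolding R2 by (simp add: power_divide)
  qed
  have Xl: "999/1000 / \<eta> \<le> X^2" "X^2 \<le> 1 / \<eta>" using R1 Rl eta0 unfolding X2 by (simp_all add: field_simps)
  have i: "1 / \<eta> = (1 / a^2)^2" unfolding eta by (simp add: power_divide flip: power_mult)
  define b where "b = 1 / a^2"
  have b0: "0 < b" unfolding b_def using a by simp
  have ib: "1 / \<eta> = b^2" using i unfolding b_def .
  have X3: "X \<le> b" by (rule power2_le_imp_le) (use Xl(2) b0 ib in auto)
  have X4: "999/1000 * b \<le> X"
  proof (rule power2_le_imp_le)
    have "(999/1000 * b)^2 = (999/1000) * (999/1000) * (1/\<eta>)" unfolding ib by (simp add: power2_eq_square)
    also have "\<dots> \<le> 999/1000 * (1 / \<eta>)" using eta0 by (intro mult_right_mono) auto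
    finally show "(999/1000 * b)^2 \<le> X^2" using Xl(1) by simp
  qed (use X0 in simp)
  have h: "13 * a^5 < h" "h < 1/5 * \<kappa> * b" using x unfolding h_def X_def b_def by auto
  have h0: "0 < h" using h(1) a by (meson less_trans mult_pos_pos zero_less_numeral zero_less_power)
  have x0: "0 < x" "X < x" using h0 X0 unfolding h_def by simp_all
  have q: "9999/10000 \<le> q" "q \<le> 10001/10000" using d unfolding q_def by linarith+
  have "0 < x * y" using q unfolding q_def by simp
  thus y0: "0 < y" using x0 by (simp add: zero_less_mult_iff)
  have yq: "y = q / x" unfolding q_def using x0 by simp
  define T where "T = 1 / X^2 - y^2"
  define D where "D = x^2 - y^2"
  have DR: "D - R = h * (2 * X + h) + T"
  proof -
    have "X^2 - 1 / X^2 = R" using X2 Xi by argo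
    thus ?thesis unfolding D_def T_def h_def by (simp add: power2_eq_square algebra_simps)
  qed
  have Xi': "1 / X^2 \<le> 101/100 * \<eta>"
  proof -
    have "1 / X^2 \<le> 1 / (999/1000 / \<eta>)" using Xl(1) eta0 X0 by (intro divide_left_mono) auto
    also have "\<dots> \<le> 101/100 * \<eta>" using eta0 by simp
    finally show ?thesis .
  qed
  have Tu: "T \<le> 101/100 * \<eta>" unfolding T_def using Xi' zero_le_power2[of y] by linarith
  \<comment> \<open>\<open>y = q / x\<close> with \<open>x\<close> above \<open>X\<close> and
    \<open>q\<close> near 1, so \<open>y^2\<close> hardly exceeds \<open>1 / X^2\<close>.\<close>
  have Tl: "- (1/1000) * \<eta> \<le> T"
  proof -
    have "X^2 \<le> x^2" using x0 X0 by (intro power_mono) auto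
    hence "y^2 \<le> q^2 / X^2" unfolding yq power_divide using X0 x0 by (intro divide_left_mono) auto
    hence "T \<ge> (1 - q^2) * (1 / X^2)" unfolding T_def by (simp add: diff_divide_distrib)
    moreover have "q^2 \<le> (10001/10000)^2" using q by (intro power_mono) auto
    hence "1 - q^2 \<ge> - (3/10000)" by (simp add: power2_eq_square)
    hence "(1 - q^2) * (1 / X^2) \<ge> - (3/10000) * (1 / X^2)" using X0 by (intro mult_right_mono) auto
    moreover have "- (3/10000) * (1 / X^2) \<ge> - (3/10000) * (101/100 * \<eta>)" using Xi' by simp
    ultimately show ?thesis using eta0 by argo
  qed
  have ab: "a^5 * b = a^3" unfolding b_def using a by (simp add: field_simps flip: power_add)
  have low1: "25 * a^3 \<le> D - R"
  proof -
    have "13 * a^5 * (2 * (999/1000 * b)) \<le> h * (2 * X + h)"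
      using h h0 X4 a b0 by (intro mult_mono) auto
    moreover have "13 * a^5 * (2 * (999/1000 * b)) = 25974/1000 * a^3" using ab by (simp add: mult_ac)
    moreover have "\<eta> \<le> a^3" unfolding eta using a a1 by (intro power_decreasing) auto
    ultimately show ?thesis using Tl a zero_less_power[of a 3] unfolding DR by linarith
  qed
  have up1: "D - R \<le> 42/100 * \<kappa> * (1 / \<eta>)"
  proof -
    have "\<kappa> * b \<le> (1/100) * b" using b0 \<kappa> by (intro mult_right_mono) auto
    hence "2 * X + h \<le> 201/100 * b" using X3 h b0 by linarith
    hence "h * (2 * X + h) \<le> (1/5 * \<kappa> * b) * (201/100 * b)"
      using h h0 X0 b0 kap0 by (intro mult_mono) auto
    also have "\<dots> = 402/1000 * \<kappa> * (1 / \<eta>)" unfolding ib by (simp add: power2_eq_square)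
    finally have 1: "h * (2 * X + h) \<le> 402/1000 * \<kappa> * (1 / \<eta>)" .
    have "\<eta> * \<eta> \<le> (\<kappa> / 8000000) * 1" using eta0 eta(2) etas by (intro mult_mono) auto
    hence "\<eta> \<le> \<kappa> / 8000000 * (1 / \<eta>)" using eta0 by (simp add: field_simps)
    moreover have "0 < \<kappa> * (1 / \<eta>)" using kap0 eta0 by simp
    ultimately show ?thesis using 1 Tu unfolding DR by linarith
  qed
  have a3: "0 < a^3" using a by simp
  have plus: "199/100 * (1 / \<eta>) \<le> D + R" "D + R \<le> 201/100 * (1 / \<eta>)"
  proof -
    have pe: "0 < 1 / \<eta>" using eta0 by simp
    have "999/1000 * (1 / \<eta>) \<le> R" using Rl by simp
    thus "199/100 * (1 / \<eta>) \<le> D + R" using low1 a3 pe by linarith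
    have "\<kappa> * (1 / \<eta>) \<le> (1/100) * (1 / \<eta>)" using \<kappa> eta0 by (intro mult_right_mono) auto
    thus "D + R \<le> 201/100 * (1 / \<eta>)" using up1 R1 pe by linarith
  qed
  define s where "s = \<eta> * sqrt (D^2 + 4)"
  have ex: "excess \<eta> x y = s - 1" unfolding excess_def s_def D_def by simp
  have "s^2 = \<eta>^2 * (D^2 + 4)" unfolding s_def by (simp add: power_mult_distrib)
  \<comment> \<open>\<open>R\<close> is the balance of excess 0, so the difference of squares
    isolates \<open>D - R\<close>.\<close>
  moreover have "1 = \<eta>^2 * (R^2 + 4)" unfolding R2 using eta0 by simp
  ultimately have ss: "s^2 - 1 = \<eta>^2 * ((D - R) * (D + R))" by (simp add: power2_eq_square algebra_simps)
  have eb: "\<eta>^2 * (c * (1 / \<eta>) * (1 / \<eta>)) = c" for c using eta0 by (simp add: power2_eq_square)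
  have D0: "0 < D - R" using low1 a3 by linarith
  have low2: "49 * a^7 \<le> s^2 - 1"
  proof -
    have "\<eta>^2 * (25 * a^3 * (199/100 * (1 / \<eta>))) \<le> \<eta>^2 * ((D - R) * (D + R))"
      by (intro mult_left_mono mult_mono low1 plus) (use D0 eta0 in simp_all)
    moreover have "\<eta>^2 * (25 * a^3 * (199/100 * (1 / \<eta>))) = 4975/100 * (a^3 * \<eta>)"
      using eta0 by (simp add: power2_eq_square)
    moreover have "a^3 * \<eta> = a^7" unfolding eta by (simp flip: power_add)
    moreover have "0 < a^7" using a by simp
    ultimately show ?thesis unfolding ss by linarith
  qed
  have up2: "s^2 - 1 \<le> \<kappa>"
  proof -
    have "\<eta>^2 * ((D - R) * (D + R)) \<le> \<eta>^2 * ((42/100 * \<kappa> * (1 / \<eta>)) * (201/100 * (1 / \<eta>)))"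
      by (intro mult_left_mono mult_mono up1 plus) (use D0 R0 eta0 kap0 in simp_all)
    also have "\<dots> = 8442/10000 * \<kappa>" using eb[of "8442/10000 * \<kappa>"] by (simp add: mult_ac)
    finally show ?thesis unfolding ss using kap0 by simp
  qed
  have s0: "0 \<le> s" unfolding s_def using eta0 by simp
  have a7: "0 < a^7" using a by simp
  have "1^2 \<le> s^2" unfolding one_power2 using low2 a7 by linarith
  hence s1: "1 \<le> s" using s0 by (rule power2_le_imp_le)
  have "s^2 \<le> (101/100)^2" using up2 \<kappa> by (simp add: power2_eq_square)
  hence s2: "s \<le> 101/100" by (rule power2_le_imp_le) simp
  have fac: "s^2 - 1 = (s - 1) * (s + 1)" by (simp add: power2_eq_square algebra_simps)
  have "(s - 1) * 1 \<le> (s - 1) * (s + 1)" using s1 by (intro mult_left_mono) auto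
  thus "excess \<eta> x y \<le> \<kappa>" using up2 unfolding ex fac by simp
  have "49 * a^7 \<le> (s - 1) * (s + 1)" using low2 unfolding fac .
  also have "\<dots> \<le> (s - 1) * (201/100)" using s1 s2 by (intro mult_left_mono) auto
  finally show "20 * a^7 \<le> excess \<eta> x y" using a7 unfolding ex by argo
  have "y^2 < x^2" using D0 R0 unfolding D_def by simp
  thus "y < x" by (rule power2_less_imp_less) (use x0 in simp)
qed

section \<open>From even times to all times, and back to the coordinates\<close>

lemma LIMSEQ_even_odd:
  fixes f :: "nat \<Rightarrow> 'a::topological_space"
  assumes "(\<lambda>n. f (2 * n)) \<longlonglongrightarrow> l" "(\<lambda>n. f (Suc (2 * n))) \<longlonglongrightarrow> l"
  shows "f \<longlonglongrightarrow> l"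
proof (rule topological_tendstoI)
  fix S assume "open S" "l \<in> S"
  then obtain M N where M: "\<And>n. M \<le> n \<Longrightarrow> f (2 * n) \<in> S" and N: "\<And>n. N \<le> n \<Longrightarrow> f (Suc (2 * n)) \<in> S"
    using assms[THEN topological_tendstoD] unfolding eventually_sequentially by meson
  have "f k \<in> S" if "2 * (M + N) + 1 \<le> k" for k
  proof (cases "even k")
    case True
    then obtain n where "k = 2 * n" by blast
    thus ?thesis using M[of n] that by simp
  next
    case False
    then obtain n where "k = Suc (2 * n)" by (metis oddE Suc_eq_plus1)
    thus ?thesis using N[of n] that by simp
  qed
  thus "\<forall>\<^sub>F k in sequentially. f k \<in> S" unfolding eventually_sequentially by blast
qed

text \<open>The excess determines \<open>x^2 - y^2\<close>, which is positive, and with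
  \<open>x * y\<close> also \<open>x^2 + y^2\<close>. Thus a point is a continuous function of its
  excess and product, and convergence of these two gives convergence of the coordinates.\<close>

lemma gd_recover_point:
  assumes "0 < \<eta>" "0 < y" "y < x"
  defines "D \<equiv> sqrt (((1 + excess \<eta> x y) / \<eta>)^2 - 4)"
  shows "x = sqrt ((sqrt (D^2 + 4 * (x * y)^2) + D) / 2)" "y = sqrt ((sqrt (D^2 + 4 * (x * y)^2) - D) / 2)"
proof -
  have "y^2 < x^2" using assms by (intro power_strict_mono) auto
  hence D: "D = x^2 - y^2" unfolding D_def excess_def using assms(1) by simp
  have "D^2 + 4 * (x * y)^2 = (x^2 + y^2)^2" unfolding D by (simp add: power2_eq_square algebra_simps)
  hence S: "sqrt (D^2 + 4 * (x * y)^2) = x^2 + y^2" by simp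
  show "x = sqrt ((sqrt (D^2 + 4 * (x * y)^2) + D) / 2)" "y = sqrt ((sqrt (D^2 + 4 * (x * y)^2) - D) / 2)"
    unfolding S unfolding D using assms by simp_all
qed

text \<open>\<open>slow_fast_limit\<close> governs the even times. At odd times the excess lies
  between its even neighbours and the residual is at most twice the preceding one.\<close>

lemma gd_limit:
  fixes x y :: "nat \<Rightarrow> real"
  assumes eta: "0 < \<eta>" "\<eta> \<le> 1/1000000000" and gd: "gd_trajectory \<eta> x y"
    and pos: "0 < y 0" "y 0 < x 0"
    and d0: "x 0 * y 0 \<noteq> 1" "\<bar>x 0 * y 0 - 1\<bar> \<le> 1/10000"
    and e0: "0 \<le> excess \<eta> (x 0) (y 0)" "excess \<eta> (x 0) (y 0) \<le> 1/100000000"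
    and gap: "exp ((3/2) * (1 - excess \<eta> (x 0) (y 0) / \<eta>^2)) \<le> \<eta>^2"
  shows "\<exists>L. - 2 * \<eta>^2 \<le> L \<and> L < 0 \<and> (\<lambda>t. excess \<eta> (x t) (y t)) \<longlonglongrightarrow> L \<and> (\<lambda>t. x t * y t) \<longlonglongrightarrow> 1"
    and "\<forall>t. 0 < y t \<and> y t < x t"
proof -
  define \<delta> where "\<delta> t = x t * y t - 1" for t
  define \<epsilon> where "\<epsilon> t = excess \<eta> (x t) (y t)" for t
  define u where "u n = (\<delta> (2 * n))^2" for n
  define P where "P n \<longleftrightarrow> 0 < y (2 * n) \<and> y (2 * n) < x (2 * n)" for n
  note two = gd_two_steps[OF gd eta, folded \<delta>_def \<epsilon>_def]
  have eta2: "\<eta>^2 \<le> 1/1000000000"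
    using power_mono[of \<eta> "1/1000000000" 2] eta by (simp add: power2_eq_square)
  have step: "slow_fast_step \<eta> (u n) (\<epsilon> (2 * n)) (u (Suc n)) (\<epsilon> (2 * Suc n)) \<and> P (Suc n)"
    if "P n" "0 < u n" "u n \<le> 1/100000000" "\<bar>\<epsilon> (2 * n)\<bar> \<le> 1/100000000" for n
    using two[of "2 * n"] that unfolding u_def P_def by simp
  have P0: "P 0" using pos unfolding P_def by simp
  have "\<bar>\<delta> 0\<bar>^2 \<le> (1/10000)^2" using d0 unfolding \<delta>_def by (intro power_mono) auto
  hence u0: "0 < u 0" "u 0 \<le> 1/100000000"
    using d0 unfolding u_def \<delta>_def by simp_all (simp add: power2_eq_square)
  have e0': "0 \<le> \<epsilon> (2 * 0)" "\<epsilon> (2 * 0) \<le> 1/100000000"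
    "exp ((3/2) * (1 - \<epsilon> (2 * 0) / \<eta>^2)) \<le> \<eta>^2" using e0 gap unfolding \<epsilon>_def by simp_all
  note lim = slow_fast_limit[where \<epsilon> = "\<lambda>n. \<epsilon> (2 * n)" and u = u and P = P,
      OF eta(1) eta2 P0 step u0 e0']
  have inv: "0 < y (2 * n)" "y (2 * n) < x (2 * n)" "(\<delta> (2 * n))^2 \<le> 1/100000000" "\<bar>\<epsilon> (2 * n)\<bar> \<le> 1/100000000" for n
    using lim(1) unfolding P_def u_def by auto
  note odd = two[OF inv]
  show "\<forall>t. 0 < y t \<and> y t < x t"
  proof
    fix t show "0 < y t \<and> y t < x t"
      using inv(1,2)[of "t div 2"] odd(5,6)[of "t div 2"] by (cases "even t") (auto elim!: evenE oddE)
  qed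
  from lim(2) obtain L where L: "- 2 * \<eta>^2 \<le> L" "L < 0" "(\<lambda>n. \<epsilon> (2 * n)) \<longlonglongrightarrow> L" "u \<longlonglongrightarrow> 0" by blast
  have next_even: "(\<lambda>n. \<epsilon> (Suc (Suc (2 * n)))) \<longlonglongrightarrow> L" using LIMSEQ_Suc[OF L(3)] by simp
  have "(\<lambda>n. \<epsilon> (Suc (2 * n))) \<longlonglongrightarrow> L"
    by (rule tendsto_sandwich[OF _ _ next_even L(3)]) (use odd(3,4) in \<open>auto intro: always_eventually\<close>)
  with L(3) have eL: "\<epsilon> \<longlonglongrightarrow> L" by (rule LIMSEQ_even_odd)
  have "(\<lambda>n. sqrt (u n)) \<longlonglongrightarrow> sqrt 0" using L(4) by (rule tendsto_real_sqrt)
  hence ev: "(\<lambda>n. \<bar>\<delta> (2 * n)\<bar>) \<longlonglongrightarrow> 0" unfolding u_def by simp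
  hence twice: "(\<lambda>n. 2 * \<bar>\<delta> (2 * n)\<bar>) \<longlonglongrightarrow> 0" by (rule tendsto_mult_right_zero)
  have "(\<lambda>n. \<bar>\<delta> (Suc (2 * n))\<bar>) \<longlonglongrightarrow> 0"
    by (rule tendsto_sandwich[OF _ _ tendsto_const twice]) (use odd(2) in \<open>auto intro: always_eventually\<close>)
  with ev have "(\<lambda>t. \<bar>\<delta> t\<bar>) \<longlonglongrightarrow> 0" by (rule LIMSEQ_even_odd)
  hence "\<delta> \<longlonglongrightarrow> 0" by (simp add: tendsto_rabs_zero_iff)
  hence "(\<lambda>t. \<delta> t + 1) \<longlonglongrightarrow> 0 + 1" by (intro tendsto_intros)
  hence "(\<lambda>t. x t * y t) \<longlonglongrightarrow> 1" unfolding \<delta>_def by simp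
  thus "\<exists>L. - 2 * \<eta>^2 \<le> L \<and> L < 0 \<and> (\<lambda>t. excess \<eta> (x t) (y t)) \<longlonglongrightarrow> L \<and> (\<lambda>t. x t * y t) \<longlonglongrightarrow> 1"
    using L eL unfolding \<epsilon>_def by blast
qed

lemma gd_converges:
  fixes x y :: "nat \<Rightarrow> real"
  assumes eta: "0 < \<eta>" "\<eta> \<le> 1/1000000000" and pos: "\<forall>t. 0 < y t \<and> y t < x t"
    and L: "- 2 * \<eta>^2 \<le> L" "L < 0" "(\<lambda>t. excess \<eta> (x t) (y t)) \<longlonglongrightarrow> L"
    and q: "(\<lambda>t. x t * y t) \<longlonglongrightarrow> 1"
  shows "\<exists>xl yl. x \<longlonglongrightarrow> xl \<and> y \<longlonglongrightarrow> yl \<and> global_minimum xl yl \<and> sharpness xl yl = 2 * (1 + L) / \<eta>"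
proof -
  define D where "D e = sqrt (((1 + e) / \<eta>)^2 - 4)" for e
  define X where "X e p = sqrt ((sqrt ((D e)^2 + 4 * p^2) + D e) / 2)" for e p
  define Y where "Y e p = sqrt ((sqrt ((D e)^2 + 4 * p^2) - D e) / 2)" for e p
  have xy: "x = (\<lambda>t. X (excess \<eta> (x t) (y t)) (x t * y t))" "y = (\<lambda>t. Y (excess \<eta> (x t) (y t)) (x t * y t))"
    unfolding X_def Y_def D_def fun_eq_iff using gd_recover_point[OF eta(1)] pos by blast+
  have "(\<lambda>t. X (excess \<eta> (x t) (y t)) (x t * y t)) \<longlonglongrightarrow> X L 1"
    "(\<lambda>t. Y (excess \<eta> (x t) (y t)) (x t * y t)) \<longlonglongrightarrow> Y L 1"
    unfolding X_def Y_def D_def using eta by (intro tendsto_intros L(3) q; simp)+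
  hence lim: "x \<longlonglongrightarrow> X L 1" "y \<longlonglongrightarrow> Y L 1" using xy by simp_all
  define S where "S = (1 + L) / \<eta>"
  have "\<eta>^2 \<le> 1/1000000000"
    using power_mono[of \<eta> "1/1000000000" 2] eta by (simp add: power2_eq_square)
  hence "1/2 \<le> 1 + L" using L(1) by simp
  hence "4 * \<eta> \<le> 1 + L" using eta by simp
  \<comment> \<open>This makes \<open>S^2 - 4\<close> nonnegative, so the square root in
    \<open>D L\<close> squares back to it.\<close>
  hence S4: "4 \<le> S" unfolding S_def using eta by (simp add: field_simps)
  hence "4^2 \<le> S^2" by (intro power_mono) auto
  hence DL: "(D L)^2 = S^2 - 4" "0 \<le> D L" unfolding D_def S_def[symmetric] by simp_all
  hence "(D L)^2 \<le> S^2" by simp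
  hence DS: "D L \<le> S" by (rule power2_le_imp_le) (use S4 in simp)
  have S: "sqrt ((D L)^2 + 4 * 1^2) = S" using DL S4 by simp
  have X: "(X L 1)^2 = (S + D L) / 2" "0 \<le> X L 1" and Y: "(Y L 1)^2 = (S - D L) / 2" "0 \<le> Y L 1"
    unfolding X_def Y_def S using DL DS S4 by simp_all
  have m: "(X L 1)^2 * (Y L 1)^2 = 1" unfolding X Y using DL by (simp add: field_simps power2_eq_square)
  hence "(X L 1 * Y L 1)^2 = 1^2" by (simp add: power_mult_distrib)
  hence "X L 1 * Y L 1 = 1" by (rule power2_eq_imp_eq) (use X Y in auto)
  hence "sharpness (X L 1) (Y L 1) = 2 * ((X L 1)^2 + (Y L 1)^2)" by (rule sharpness_at_minimum)
  also have "\<dots> = 2 * S" unfolding X Y by argo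
  finally have "sharpness (X L 1) (Y L 1) = 2 * (1 + L) / \<eta>" unfolding S_def by simp
  thus ?thesis using lim m unfolding global_minimum_def by blast
qed

text \<open>Invert \<open>1 / a \<le> exp (1 / a)\<close> and take the \<open>n\<close>-th
  power.\<close>

lemma exp_neg_inverse_power_le:
  fixes a :: real
  assumes "0 < a"
  shows "exp (- (real n / a)) \<le> a ^ n"
proof -
  have "1 / a \<le> exp (1 / a)" using exp_ge_add_one_self[of "1 / a"] by linarith
  hence "exp (- (1 / a)) \<le> a" using assms by (simp add: exp_minus field_simps)
  hence "exp (- (1 / a)) ^ n \<le> a ^ n" by (intro power_mono) auto
  thus ?thesis by (simp flip: exp_of_nat_mult)
qed

theorem corollary3p1:
  shows "\<exists>K0::real. K0 > 0 \<and> (\<forall>K\<ge>K0. \<forall>(\<eta>::real) (x::nat \<Rightarrow> real) (y::nat \<Rightarrow> real).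
    0 < \<eta> \<longrightarrow> \<eta> < 1 / 8000000 * (1 / K^2) \<longrightarrow>
    x 0 \<in> {x_eos \<eta> + 13 * \<eta> powr (5/4) <..< x_eos \<eta> + 1/5 * (1 / K^2) * \<eta> powr (-1/2)} \<longrightarrow>
    \<bar>x 0 * y 0 - 1\<bar> \<in> {0 <..< 1 / K} \<longrightarrow>
    gd_trajectory \<eta> x y \<longrightarrow>
    (\<exists>xl yl. x \<longlonglongrightarrow> xl \<and> y \<longlonglongrightarrow> yl \<and> global_minimum xl yl \<and>
       sharpness xl yl \<in> {2 / \<eta> - 20/3 * \<eta> <..< 2 / \<eta>}))"
proof (rule exI[of _ 10000], intro conjI allI impI)
  \<comment> \<open>With \<open>K0 = 10000\<close> the bounds \<open>1 / K \<le> 1/10000\<close> and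
    \<open>1 / K^2 \<le> 1/100000000\<close> are those of the local analysis.\<close>
  fix K \<eta> :: real and x y :: "nat \<Rightarrow> real"
  assume K: "10000 \<le> K" and eta: "0 < \<eta>" "\<eta> < 1 / 8000000 * (1 / K^2)"
    and x0: "x 0 \<in> {x_eos \<eta> + 13 * \<eta> powr (5/4) <..< x_eos \<eta> + 1/5 * (1 / K^2) * \<eta> powr (-1/2)}"
    and d0: "\<bar>x 0 * y 0 - 1\<bar> \<in> {0 <..< 1 / K}"
    and gd: "gd_trajectory \<eta> x y"
  define \<kappa> where "\<kappa> = 1 / K^2"
  define a where "a = \<eta> powr (1/4)"
  have a0: "0 < a" unfolding a_def using eta by simp
  have ap: "a ^ n = \<eta> powr (n / 4)" for n
    unfolding a_def using eta by (simp add: powr_powr flip: powr_realpow)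
  have a4: "\<eta> = a^4" using ap[of 4] eta by simp
  have "\<eta> powr (-1/2) = 1 / \<eta> powr (1/2)" using eta by (simp add: powr_minus_divide)
  hence powrs: "\<eta> powr (5/4) = a^5" "\<eta> powr (-1/2) = 1 / a^2" using ap[of 5] ap[of 2] by simp_all
  have "10000^2 \<le> K^2" using K by (intro power_mono) auto
  hence "1 / K^2 \<le> 1 / 10000^2" using K by (intro divide_left_mono) auto
  hence \<kappa>: "\<kappa> \<le> 1/100000000" unfolding \<kappa>_def by simp
  have "1 / K \<le> 1/10000" using K by (simp add: field_simps)
  hence d: "\<bar>x 0 * y 0 - 1\<bar> \<le> 1/10000" "x 0 * y 0 \<noteq> 1" using d0 by auto
  have eta\<kappa>: "\<eta> \<le> \<kappa> / 8000000" using eta(2) unfolding \<kappa>_def by simp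
  have eta9: "\<eta> \<le> 1/1000000000" using eta\<kappa> \<kappa> by linarith
  have "x_eos \<eta> + 13 * a^5 < x 0" "x 0 < x_eos \<eta> + 1/5 * \<kappa> * (1 / a^2)"
    using x0 unfolding \<kappa>_def powrs by auto
  note init = initial_excess[OF a0 a4 eta\<kappa> \<kappa> this d(1)]
  have a7: "0 < a^7" using a0 by simp
  have "a^4 < 1^4" using a4 eta9 by simp
  hence a1: "a < 1" using a0 by (rule_tac power_less_imp_less_base[of a 4]) auto
  have gap: "exp ((3/2) * (1 - excess \<eta> (x 0) (y 0) / \<eta>^2)) \<le> \<eta>^2"
  proof -
    \<comment> \<open>The initial excess is at least \<open>20 / a\<close> times
      \<open>\<eta>^2\<close>. The exponent is then at most \<open>3/2 - 30 / a\<close>, well below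
      \<open>- 8 / a\<close>, and the power 8 is needed because
      \<open>\<eta>^2 = a^8\<close>.\<close>
    have "20 / a = 20 * a^7 / \<eta>^2" unfolding a4 using a0 by (simp add: field_simps flip: power_mult power_Suc)
    also have "\<dots> \<le> excess \<eta> (x 0) (y 0) / \<eta>^2" using init(1) by (intro divide_right_mono) auto
    finally have "(3/2) * (1 - excess \<eta> (x 0) (y 0) / \<eta>^2) \<le> 3/2 - 30 / a" by argo
    also have "\<dots> \<le> - (real 8 / a)"
    proof -
      have "1 \<le> 1 / a" using a0 a1 by simp
      thus ?thesis by simp
    qed
    finally have "exp ((3/2) * (1 - excess \<eta> (x 0) (y 0) / \<eta>^2)) \<le> exp (- (real 8 / a))" by simp
    also have "\<dots> \<le> a^8" by (rule exp_neg_inverse_power_le[OF a0])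
    also have "\<dots> = \<eta>^2" unfolding a4 by (simp flip: power_mult)
    finally show ?thesis .
  qed
  have "0 \<le> excess \<eta> (x 0) (y 0)" "excess \<eta> (x 0) (y 0) \<le> 1/100000000" using init(1,2) a7 \<kappa> by linarith+
  note lim = gd_limit[OF eta(1) eta9 gd init(3,4) d(2,1) this gap]
  from lim(1) obtain L where L: "- 2 * \<eta>^2 \<le> L" "L < 0" "(\<lambda>t. excess \<eta> (x t) (y t)) \<longlonglongrightarrow> L"
    "(\<lambda>t. x t * y t) \<longlonglongrightarrow> 1" by blast
  obtain xl yl where l: "x \<longlonglongrightarrow> xl" "y \<longlonglongrightarrow> yl" "global_minimum xl yl"
    and sh: "sharpness xl yl = 2 * (1 + L) / \<eta>" using gd_converges[OF eta(1) eta9 lim(2) L] by blast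
  \<comment> \<open>The lower bound on \<open>L\<close> puts the sharpness at
    \<open>2 / \<eta> - 4 * \<eta>\<close> or above, inside the claimed interval.\<close>
  have "L / \<eta> < 0" using L(2) eta by (simp add: divide_neg_pos)
  moreover have "- 2 * \<eta>^2 / \<eta> \<le> L / \<eta>" using L(1) eta by (intro divide_right_mono) auto
  hence "- 2 * \<eta> \<le> L / \<eta>" using eta by (simp add: power2_eq_square)
  moreover have "sharpness xl yl = 2 / \<eta> + 2 * (L / \<eta>)" unfolding sh by (simp add: add_divide_distrib algebra_simps)
  ultimately have "sharpness xl yl \<in> {2 / \<eta> - 20/3 * \<eta> <..< 2 / \<eta>}" using eta(1) by simp
  thus "\<exists>xl yl. x \<longlonglongrightarrow> xl \<and> y \<longlonglongrightarrow> yl \<and> global_minimum xl yl \<and>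
       sharpness xl yl \<in> {2 / \<eta> - 20/3 * \<eta> <..< 2 / \<eta>}" using l by blast
qed simp

end
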